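(* Let $M$ be a smooth manifold with a $B$-field $B$, and let $\mathcal L^B\to LM$ be the associated holonomy line bundle over the free loop space with its natural connection $\nabla^{\mathcal L^B}$. For every $(L,\nabla^L)\in\mathrm{Pic}^\nabla(M)$, $$\nabla^{\mathcal L^{(L,\nabla^L)\cdot B}}=\nabla^{\mathcal L^B}+d\ln\mathrm{hol}(\nabla^L),$$ where $\mathrm{hol}(\nabla^L):LM\to\mathbb T$ is the holonomy of the connection $\nabla^L$ around loops.
   Context: $\mathbb T=U(1)$. $LM$ is the free loop space of $M$, $ev:S^1\times LM\to M$ the evaluation map, and $K$ the vector field on $LM$ generating loop rotation. For $\omega\in\Omega^i(M)$ and $s\in[0,1]$, $\widehat\omega_s\in\Omega^i(LM)$ is $\widehat\omega_s(X_1,\dots,X_i)(\gamma)=\omega(X_1|_{\gamma(s)},\dots,X_i|_{\gamma(s)})$, $\overline\omega=\int_0^1\widehat\omega_s\,ds$, and the transgression is $\tau(\omega)=\int_{S^1}ev^*\omega=\iota_K\overline\omega\in\Omega^{i-1}(LM)$. Let $\{\mathsf U_\alpha\}$ be a Brylinski open cover of $M$: a maximal family of open sets with $H^2(\mathsf U_{\alpha_I})=H^3(\mathsf U_{\alpha_I})=0$ for all finite intersections $\mathsf U_{\alpha_I}$; then $\{L\mathsf U_\alpha\}$ covers $LM$. Let $H$ be a closed $3$-form on $M$ with integral periods (up to normalization by factors of $2\pi i$), $H|_{\mathsf U_\alpha}=dB_\alpha$ with $B_\alpha$ purely imaginary $2$-forms and $B_\beta-B_\alpha=dA_{\alpha\beta}$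 with $A_{\alpha\beta}$ purely imaginary $1$-forms; $(H,B,A)$ is a connective structure with curving on a gerbe on $M$, and $B=\{B_\alpha\}$ is the $B$-field. The holonomy of the gerbe defines a line bundle $\mathcal L^B\to LM$ with Brylinski local sections $\sigma_\alpha$ over $L\mathsf U_\alpha$ satisfying $\sigma_\alpha=e^{-\tau(A_{\alpha\beta})}\sigma_\beta$ on overlaps, and a natural connection which in the basis $\{\sigma_\alpha\}$ is $$\nabla^{\mathcal L^B}=d-\iota_K\overline{B}_\alpha=d-\tau(B_\alpha).$$ $\mathrm{Pic}^\nabla(M)$ is the Picard group of line bundles with (unitary) connection on $M$; it acts on $B$-fields by $(L,\nabla^L)\cdot B=\{B_\alpha+(\nabla^L)^2\}$, leaving the $A_{\alpha\beta}$ (hence the bundle $\mathcal L^B$ and its local sections) unchanged. Sign convention: for $\nabla^L=d+a$ locally, $\mathrm{hol}(\nabla^L)(\gamma)=\exp(\int_\gamma a)$, so that $d\ln\mathrm{hol}(\nabla^L)=-\iota_K\overline{(\nabla^L)^2}$. *)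

theory Defs
  imports "HOL-Analysis.Analysis" "HOL-Homology.Homology"
begin

section \<open>Smooth maps and smooth manifolds\<close>

text \<open>For maps between finite-dimensional spaces on an open set S, \<open>ck_on k S f\<close> says that
  f is of class \<open>C\<^sup>k\<close> on S.\<close>

primrec ck_on ::
    "nat \<Rightarrow> 'a::real_normed_vector set \<Rightarrow> ('a \<Rightarrow> 'b::real_normed_vector) \<Rightarrow> bool" where
  "ck_on 0 S f = continuous_on S f"
| "ck_on (Suc k) S f =
     ((\<forall>x\<in>S. f differentiable (at x)) \<and> (\<forall>u. ck_on k S (\<lambda>x. frechet_derivative f (at x) u)))"

definition smooth_on :: "'a::real_normed_vector set \<Rightarrow> ('a \<Rightarrow> 'b::real_normed_vector) \<Rightarrow> bool" where
  "smooth_on S f \<longleftrightarrow> open S \<and> (\<forall>k. ck_on k S f)"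

text \<open>The manifold M is the whole (Hausdorff, second countable) type \<open>'m\<close>; a chart is a pair of
  its domain and its coordinate map, whose values outside the domain are irrelevant.\<close>

type_synonym ('m, 'e) chart = "'m set \<times> ('m \<Rightarrow> 'e)"

definition chart_inv :: "('m, 'e) chart \<Rightarrow> 'e \<Rightarrow> 'm" where
  "chart_inv c = inv_into (fst c) (snd c)"

definition smooth_atlas ::
    "('m::{t2_space,second_countable_topology}, 'e::euclidean_space) chart set \<Rightarrow> bool" where
  "smooth_atlas \<A> \<longleftrightarrow>
     (\<Union>c\<in>\<A>. fst c) = UNIV \<and>
     (\<forall>c\<in>\<A>. open (fst c) \<and> open (snd c ` fst c) \<and>
        homeomorphism (fst c) (snd c ` fst c) (snd c) (chart_inv c)) \<and>
     (\<forall>c\<in>\<A>. \<forall>d\<in>\<A>. smooth_on (snd c ` (fst c \<inter> fst d)) (snd d \<circ> chart_inv c))"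

definition smooth_into ::
    "('m::topological_space, 'e::euclidean_space) chart set \<Rightarrow> 'a::euclidean_space set
      \<Rightarrow> ('a \<Rightarrow> 'm) \<Rightarrow> bool" where
  "smooth_into \<A> S f \<longleftrightarrow> open S \<and> continuous_on S f \<and>
     (\<forall>c\<in>\<A>. smooth_on (S \<inter> f -` fst c) (snd c \<circ> f))"

definition smooth_fun ::
    "('m, 'e::euclidean_space) chart set \<Rightarrow> 'm set \<Rightarrow> ('m \<Rightarrow> complex) \<Rightarrow> bool" where
  "smooth_fun \<A> V h \<longleftrightarrow> (\<forall>c\<in>\<A>. smooth_on (snd c ` (fst c \<inter> V)) (h \<circ> chart_inv c))"

text \<open>A tangent vector at p is the family of its coordinate vectors in all charts around p,
  related by the Jacobians of the coordinate changes; the entries at all other charts are 0.\<close>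

type_synonym ('m, 'e) tvec = "('m, 'e) chart \<Rightarrow> 'e"

definition tangent_space ::
    "('m, 'e::euclidean_space) chart set \<Rightarrow> 'm \<Rightarrow> ('m, 'e) tvec set" where
  "tangent_space \<A> p =
     {v. (\<forall>c\<in>\<A>. \<forall>d\<in>\<A>. p \<in> fst c \<and> p \<in> fst d \<longrightarrow>
            v d = frechet_derivative (snd d \<circ> chart_inv c) (at (snd c p)) (v c)) \<and>
         (\<forall>c. c \<notin> \<A> \<or> p \<notin> fst c \<longrightarrow> v c = 0)}"

definition push ::
    "('m, 'e::euclidean_space) chart set \<Rightarrow> ('a::euclidean_space \<Rightarrow> 'm) \<Rightarrow> 'a \<Rightarrow> 'a
      \<Rightarrow> ('m, 'e) tvec" where
  "push \<A> f x u =
     (\<lambda>c. if c \<in> \<A> \<and> f x \<in> fst c then frechet_derivative (snd c \<circ> f) (at x) u else 0)"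

definition coord_vec ::
    "('m, 'e::euclidean_space) chart set \<Rightarrow> ('m, 'e) chart \<Rightarrow> 'm \<Rightarrow> 'e \<Rightarrow> ('m, 'e) tvec" where
  "coord_vec \<A> c p u = push \<A> (chart_inv c) (snd c p) u"


section \<open>Differential forms\<close>

text \<open>Complex-valued forms of all degrees share one type: a k-form is evaluated on lists of
  k tangent vectors. The degree, and the open set on which the form lives, are given by
  \<open>is_form\<close>; values at other points or on other lists carry no information.\<close>

type_synonym ('m, 'e) form = "'m \<Rightarrow> ('m, 'e) tvec list \<Rightarrow> complex"

definition tangent_lists ::
    "('m, 'e::euclidean_space) chart set \<Rightarrow> nat \<Rightarrow> 'm \<Rightarrow> ('m, 'e) tvec list set" where
  "tangent_lists \<A> k p = {vs. length vs = k \<and> set vs \<subseteq> tangent_space \<A> p}"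

definition is_form ::
    "('m, 'e::euclidean_space) chart set \<Rightarrow> nat \<Rightarrow> 'm set \<Rightarrow> ('m, 'e) form \<Rightarrow> bool" where
  "is_form \<A> k V \<omega> \<longleftrightarrow>
     (\<forall>p\<in>V. \<forall>vs\<in>tangent_lists \<A> k p.
        (\<forall>i<k. \<forall>v\<in>tangent_space \<A> p. \<forall>w\<in>tangent_space \<A> p. \<forall>a b :: real.
           \<omega> p (vs[i := \<lambda>c. a *\<^sub>R v c + b *\<^sub>R w c])
             = of_real a * \<omega> p (vs[i := v]) + of_real b * \<omega> p (vs[i := w])) \<and>
        (\<forall>i j. i < j \<and> j < k \<and> vs ! i = vs ! j \<longrightarrow> \<omega> p vs = 0)) \<and>
     (\<forall>c\<in>\<A>. \<forall>us :: 'e list. length us = k \<longrightarrow>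
        smooth_on (snd c ` (fst c \<inter> V))
          (\<lambda>x. \<omega> (chart_inv c x) (map (coord_vec \<A> c (chart_inv c x)) us)))"

definition form_eq ::
    "('m, 'e::euclidean_space) chart set \<Rightarrow> nat \<Rightarrow> 'm set \<Rightarrow> ('m, 'e) form \<Rightarrow> ('m, 'e) form
      \<Rightarrow> bool" where
  "form_eq \<A> k V \<omega> \<eta> \<longleftrightarrow> (\<forall>p\<in>V. \<forall>vs\<in>tangent_lists \<A> k p. \<omega> p vs = \<eta> p vs)"

definition imaginary_form ::
    "('m, 'e::euclidean_space) chart set \<Rightarrow> nat \<Rightarrow> 'm set \<Rightarrow> ('m, 'e) form \<Rightarrow> bool" where
  "imaginary_form \<A> k V \<omega> \<longleftrightarrow> (\<forall>p\<in>V. \<forall>vs\<in>tangent_lists \<A> k p. Re (\<omega> p vs) = 0)"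

text \<open>The exterior derivative computed in the chart c,
  \<open>d\<omega>(v\<^sub>0,\<dots>,v\<^sub>k) = \<Sum>\<^sub>i (-1)\<^sup>i (D\<omega>\<cdot>v\<^sub>i)(v\<^sub>0,\<dots>,v\<^sub>k without v\<^sub>i)\<close>; for a smooth form the value does not
  depend on the chart.\<close>

definition ext_d_in ::
    "('m, 'e::euclidean_space) chart set \<Rightarrow> ('m, 'e) chart \<Rightarrow> ('m, 'e) form \<Rightarrow> ('m, 'e) form"
where
  "ext_d_in \<A> c \<omega> p vs =
     (\<Sum>i<length vs. (- 1) ^ i *
        frechet_derivative
          (\<lambda>x. \<omega> (chart_inv c x)
                 (map (\<lambda>v. coord_vec \<A> c (chart_inv c x) (v c)) (take i vs @ drop (Suc i) vs)))
          (at (snd c p)) ((vs ! i) c))"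

definition ext_d ::
    "('m, 'e::euclidean_space) chart set \<Rightarrow> ('m, 'e) form \<Rightarrow> ('m, 'e) form" where
  "ext_d \<A> \<omega> p vs = (THE y. \<forall>c\<in>\<A>. p \<in> fst c \<longrightarrow> y = ext_d_in \<A> c \<omega> p vs)"

definition dlog_form ::
    "('m, 'e::euclidean_space) chart set \<Rightarrow> ('m \<Rightarrow> complex) \<Rightarrow> ('m, 'e) form" where
  "dlog_form \<A> h p vs = ext_d \<A> (\<lambda>q _. h q) p vs / h p"

text \<open>Vanishing of the de Rham cohomology group \<open>H\<^sup>k(V)\<close>, for k at least 1.\<close>

definition de_rham_zero ::
    "('m, 'e::euclidean_space) chart set \<Rightarrow> nat \<Rightarrow> 'm set \<Rightarrow> bool" where
  "de_rham_zero \<A> k V \<longleftrightarrow>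
     (\<forall>\<omega>. is_form \<A> k V \<omega> \<and> form_eq \<A> (Suc k) V (ext_d \<A> \<omega>) (\<lambda>_ _. 0) \<longrightarrow>
        (\<exists>\<eta>. is_form \<A> (k - 1) V \<eta> \<and> form_eq \<A> k V (ext_d \<A> \<eta>) \<omega>))"


section \<open>Periods of 3-forms\<close>

definition simplex3_param :: "real \<times> real \<times> real \<Rightarrow> nat \<Rightarrow> real" where
  "simplex3_param = (\<lambda>(x, y, z) i.
     if i = 0 then 1 - x - y - z else if i = 1 then x else if i = 2 then y
     else if i = 3 then z else 0)"

definition solid_simplex3 :: "(real \<times> real \<times> real) set" where
  "solid_simplex3 = {(x, y, z). 0 \<le> x \<and> 0 \<le> y \<and> 0 \<le> z \<and> x + y + z \<le> 1}"

definition smooth_simplex3 ::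
    "('m::topological_space, 'e::euclidean_space) chart set \<Rightarrow> ((nat \<Rightarrow> real) \<Rightarrow> 'm) \<Rightarrow> bool" where
  "smooth_simplex3 \<A> f \<longleftrightarrow>
     (\<exists>W F. solid_simplex3 \<subseteq> W \<and> smooth_into \<A> W F \<and>
        (\<forall>x\<in>solid_simplex3. F x = f (simplex3_param x)))"

definition integral_simplex3 ::
    "('m, 'e::euclidean_space) chart set \<Rightarrow> ('m, 'e) form \<Rightarrow> ((nat \<Rightarrow> real) \<Rightarrow> 'm) \<Rightarrow> complex" where
  "integral_simplex3 \<A> H f =
     integral (interior solid_simplex3) (\<lambda>x. H (f (simplex3_param x))
       (map (push \<A> (f \<circ> simplex3_param) x) [(1, 0, 0), (0, 1, 0), (0, 0, 1)]))"

text \<open>Periods in \<open>2\<pi>i\<int>\<close>, the normalization that matches purely imaginary B and A.\<close>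

definition integral_periods3 ::
    "('m::topological_space, 'e::euclidean_space) chart set \<Rightarrow> ('m, 'e) form \<Rightarrow> bool" where
  "integral_periods3 \<A> H \<longleftrightarrow>
     (\<forall>z :: 'm chain. singular_relcycle 3 euclidean {} z \<and>
          (\<forall>f \<in> Poly_Mapping.keys z. smooth_simplex3 \<A> f) \<longrightarrow>
        (\<exists>n :: int. (\<Sum>f \<in> Poly_Mapping.keys z.
             of_int (Poly_Mapping.lookup z f) * integral_simplex3 \<A> H f)
           = 2 * of_real pi * \<i> * of_int n))"


section \<open>Gerbes with connective structure and curving\<close>

definition brylinski_family ::
    "('m::topological_space, 'e::euclidean_space) chart set \<Rightarrow> 'm set set \<Rightarrow> bool" where
  "brylinski_family \<A> \<V> \<longleftrightarrow> (\<forall>V\<in>\<V>. open V) \<and>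
     (\<forall>\<I>. finite \<I> \<and> \<I> \<noteq> {} \<and> \<I> \<subseteq> \<V> \<longrightarrow>
        de_rham_zero \<A> 2 (\<Inter>\<I>) \<and> de_rham_zero \<A> 3 (\<Inter>\<I>))"

definition brylinski_cover ::
    "('m::topological_space, 'e::euclidean_space) chart set \<Rightarrow> 'm set set \<Rightarrow> bool" where
  "brylinski_cover \<A> \<V> \<longleftrightarrow> brylinski_family \<A> \<V> \<and> \<Union>\<V> = UNIV \<and>
     (\<forall>\<W>. brylinski_family \<A> \<W> \<and> \<V> \<subseteq> \<W> \<longrightarrow> \<W> = \<V>)"

text \<open>The gerbe itself is given by the \<open>U(1)\<close>-valued cocycle g on triple overlaps.\<close>

definition gerbe_connection ::
    "('m::topological_space, 'e::euclidean_space) chart set \<Rightarrow> ('i \<Rightarrow> 'm set)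
      \<Rightarrow> ('i \<Rightarrow> 'i \<Rightarrow> 'i \<Rightarrow> 'm \<Rightarrow> complex)
      \<Rightarrow> ('m, 'e) form \<Rightarrow> ('i \<Rightarrow> ('m, 'e) form) \<Rightarrow> ('i \<Rightarrow> 'i \<Rightarrow> ('m, 'e) form) \<Rightarrow> bool" where
  "gerbe_connection \<A> U g H B A \<longleftrightarrow>
     is_form \<A> 3 UNIV H \<and> form_eq \<A> 4 UNIV (ext_d \<A> H) (\<lambda>_ _. 0) \<and> integral_periods3 \<A> H \<and>
     (\<forall>\<alpha>. is_form \<A> 2 (U \<alpha>) (B \<alpha>) \<and> imaginary_form \<A> 2 (U \<alpha>) (B \<alpha>) \<and>
        form_eq \<A> 3 (U \<alpha>) H (ext_d \<A> (B \<alpha>))) \<and>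
     (\<forall>\<alpha> \<beta>. is_form \<A> 1 (U \<alpha> \<inter> U \<beta>) (A \<alpha> \<beta>) \<and> imaginary_form \<A> 1 (U \<alpha> \<inter> U \<beta>) (A \<alpha> \<beta>) \<and>
        form_eq \<A> 2 (U \<alpha> \<inter> U \<beta>) (\<lambda>p vs. B \<beta> p vs - B \<alpha> p vs) (ext_d \<A> (A \<alpha> \<beta>))) \<and>
     (\<forall>\<alpha> \<beta> \<gamma>. smooth_fun \<A> (U \<alpha> \<inter> U \<beta> \<inter> U \<gamma>) (g \<alpha> \<beta> \<gamma>) \<and>
        (\<forall>p \<in> U \<alpha> \<inter> U \<beta> \<inter> U \<gamma>. cmod (g \<alpha> \<beta> \<gamma> p) = 1) \<and>
        form_eq \<A> 1 (U \<alpha> \<inter> U \<beta> \<inter> U \<gamma>)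
          (\<lambda>p vs. A \<alpha> \<beta> p vs + A \<beta> \<gamma> p vs - A \<alpha> \<gamma> p vs) (dlog_form \<A> (g \<alpha> \<beta> \<gamma>))) \<and>
     (\<forall>\<alpha> \<beta> \<gamma> \<delta>. \<forall>p \<in> U \<alpha> \<inter> U \<beta> \<inter> U \<gamma> \<inter> U \<delta>.
        g \<beta> \<gamma> \<delta> p * g \<alpha> \<beta> \<delta> p = g \<alpha> \<gamma> \<delta> p * g \<alpha> \<beta> \<gamma> p)"


section \<open>The free loop space\<close>

text \<open>Loops are 1-periodic smooth maps on the real line. A curve in the loop space is smooth iff
  it is smooth as a map of two variables (exponential law), and the smooth structure and the
  topology of the Frechet manifold LM are those detected by smooth curves; this gives
  \<open>loop_open\<close> and \<open>loop_smooth_on\<close>. Tangent vectors at a loop are the velocities of smooth curves,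
  viewed as vector fields along the loop.\<close>

type_synonym 'm loop = "real \<Rightarrow> 'm"
type_synonym ('m, 'e) loop_tvec = "real \<Rightarrow> ('m, 'e) tvec"
type_synonym ('m, 'e) loop_form = "'m loop \<Rightarrow> ('m, 'e) loop_tvec list \<Rightarrow> complex"

definition loop_space ::
    "('m::topological_space, 'e::euclidean_space) chart set \<Rightarrow> 'm set \<Rightarrow> 'm loop set" where
  "loop_space \<A> V =
     {\<gamma>. smooth_into \<A> UNIV \<gamma> \<and> (\<forall>s. \<gamma> (s + 1) = \<gamma> s) \<and> range \<gamma> \<subseteq> V}"

definition loop_curve ::
    "('m::topological_space, 'e::euclidean_space) chart set \<Rightarrow> (real \<Rightarrow> 'm loop) \<Rightarrow> bool" where
  "loop_curve \<A> \<Gamma> \<longleftrightarrow>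
     smooth_into \<A> UNIV (\<lambda>(t, s). \<Gamma> t s) \<and> (\<forall>t s. \<Gamma> t (s + 1) = \<Gamma> t s)"

definition loop_velocity ::
    "('m, 'e::euclidean_space) chart set \<Rightarrow> (real \<Rightarrow> 'm loop) \<Rightarrow> real \<Rightarrow> ('m, 'e) loop_tvec" where
  "loop_velocity \<A> \<Gamma> t = (\<lambda>s. push \<A> (\<lambda>r. \<Gamma> r s) t 1)"

definition loop_tangent ::
    "('m::topological_space, 'e::euclidean_space) chart set \<Rightarrow> 'm loop \<Rightarrow> ('m, 'e) loop_tvec set"
where
  "loop_tangent \<A> \<gamma> = {loop_velocity \<A> \<Gamma> 0 | \<Gamma>. loop_curve \<A> \<Gamma> \<and> \<Gamma> 0 = \<gamma>}"

definition loop_open ::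
    "('m::topological_space, 'e::euclidean_space) chart set \<Rightarrow> 'm loop set \<Rightarrow> bool" where
  "loop_open \<A> W \<longleftrightarrow> W \<subseteq> loop_space \<A> UNIV \<and> (\<forall>\<Gamma>. loop_curve \<A> \<Gamma> \<longrightarrow> open (\<Gamma> -` W))"

definition loop_smooth_on ::
    "('m::topological_space, 'e::euclidean_space) chart set \<Rightarrow> 'm loop set
      \<Rightarrow> ('m loop \<Rightarrow> complex) \<Rightarrow> bool" where
  "loop_smooth_on \<A> W f \<longleftrightarrow> (\<forall>\<Gamma>. loop_curve \<A> \<Gamma> \<longrightarrow> smooth_on (\<Gamma> -` W) (f \<circ> \<Gamma>))"

text \<open>The differential \<open>df(X)\<close> at the loop \<open>\<gamma>\<close>, and \<open>d ln f = f\<^sup>-\<^sup>1 df\<close>.\<close>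

definition loop_d ::
    "('m::topological_space, 'e::euclidean_space) chart set \<Rightarrow> ('m loop \<Rightarrow> complex)
      \<Rightarrow> 'm loop \<Rightarrow> ('m, 'e) loop_tvec \<Rightarrow> complex" where
  "loop_d \<A> f \<gamma> X =
     (THE y. \<forall>\<Gamma>. loop_curve \<A> \<Gamma> \<and> \<Gamma> 0 = \<gamma> \<and> loop_velocity \<A> \<Gamma> 0 = X \<longrightarrow>
        ((\<lambda>t. f (\<Gamma> t)) has_vector_derivative y) (at 0))"

definition loop_dln ::
    "('m::topological_space, 'e::euclidean_space) chart set \<Rightarrow> ('m loop \<Rightarrow> complex)
      \<Rightarrow> 'm loop \<Rightarrow> ('m, 'e) loop_tvec \<Rightarrow> complex" where
  "loop_dln \<A> f \<gamma> X = loop_d \<A> f \<gamma> X / f \<gamma>"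

definition hat_form :: "('m, 'e) form \<Rightarrow> real \<Rightarrow> ('m, 'e) loop_form" where
  "hat_form \<omega> s \<gamma> Xs = \<omega> (\<gamma> s) (map (\<lambda>X. X s) Xs)"

definition bar_form :: "('m, 'e) form \<Rightarrow> ('m, 'e) loop_form" where
  "bar_form \<omega> \<gamma> Xs = integral {0..1} (\<lambda>s. hat_form \<omega> s \<gamma> Xs)"

definition rotation_field ::
    "('m, 'e::euclidean_space) chart set \<Rightarrow> 'm loop \<Rightarrow> ('m, 'e) loop_tvec" where
  "rotation_field \<A> \<gamma> = (\<lambda>s. push \<A> \<gamma> s 1)"

definition transgression ::
    "('m, 'e::euclidean_space) chart set \<Rightarrow> ('m, 'e) form \<Rightarrow> ('m, 'e) loop_form" where
  "transgression \<A> \<omega> \<gamma> Xs = bar_form \<omega> \<gamma> (rotation_field \<A> \<gamma> # Xs)"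


section \<open>The holonomy line bundle of a gerbe and its connection\<close>

text \<open>The total space is glued from the products of \<open>LU\<^sub>\<alpha>\<close> with the complex line, where
  \<open>(\<alpha>, \<gamma>, z)\<close> stands for \<open>z \<sigma>\<^sub>\<alpha>(\<gamma>)\<close>; hence \<open>\<sigma>\<^sub>\<alpha> = exp (-\<tau>(A\<^sub>\<alpha>\<^sub>\<beta>)) \<sigma>\<^sub>\<beta>\<close>. A point is therefore
  the set of all its coordinate representations. B does not enter.\<close>

type_synonym ('i, 'm) hol_point = "('i \<times> 'm loop \<times> complex) set"

definition gluing ::
    "('m::topological_space, 'e::euclidean_space) chart set \<Rightarrow> ('i \<Rightarrow> 'm set)
      \<Rightarrow> ('i \<Rightarrow> 'i \<Rightarrow> ('m, 'e) form) \<Rightarrow> (('i \<times> 'm loop \<times> complex) \<times> ('i \<times> 'm loop \<times> complex)) set"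
where
  "gluing \<A> U A =
     {((\<alpha>, \<gamma>, z), (\<beta>, \<gamma>, z * exp (- transgression \<A> (A \<alpha> \<beta>) \<gamma> []))) | \<alpha> \<beta> \<gamma> z.
        \<gamma> \<in> loop_space \<A> (U \<alpha>) \<and> \<gamma> \<in> loop_space \<A> (U \<beta>)}"

definition hol_fibre ::
    "('m::topological_space, 'e::euclidean_space) chart set \<Rightarrow> ('i \<Rightarrow> 'm set)
      \<Rightarrow> ('i \<Rightarrow> 'i \<Rightarrow> ('m, 'e) form) \<Rightarrow> 'm loop \<Rightarrow> ('i, 'm) hol_point set" where
  "hol_fibre \<A> U A \<gamma> = {gluing \<A> U A `` {(\<alpha>, \<gamma>, z)} | \<alpha> z. \<gamma> \<in> loop_space \<A> (U \<alpha>)}"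

definition hol_add :: "('i, 'm) hol_point \<Rightarrow> ('i, 'm) hol_point \<Rightarrow> ('i, 'm) hol_point" where
  "hol_add x y = {(\<alpha>, \<gamma>, z + w) | \<alpha> \<gamma> z w. (\<alpha>, \<gamma>, z) \<in> x \<and> (\<alpha>, \<gamma>, w) \<in> y}"

definition hol_scale :: "complex \<Rightarrow> ('i, 'm) hol_point \<Rightarrow> ('i, 'm) hol_point" where
  "hol_scale a x = {(\<alpha>, \<gamma>, a * z) | \<alpha> \<gamma> z. (\<alpha>, \<gamma>, z) \<in> x}"

definition hol_coeff :: "'i \<Rightarrow> 'm loop \<Rightarrow> ('i, 'm) hol_point \<Rightarrow> complex" where
  "hol_coeff \<alpha> \<gamma> x = (THE z. (\<alpha>, \<gamma>, z) \<in> x)"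

definition smooth_hol_section ::
    "('m::topological_space, 'e::euclidean_space) chart set \<Rightarrow> ('i \<Rightarrow> 'm set)
      \<Rightarrow> ('i \<Rightarrow> 'i \<Rightarrow> ('m, 'e) form) \<Rightarrow> 'm loop set \<Rightarrow> ('m loop \<Rightarrow> ('i, 'm) hol_point) \<Rightarrow> bool"
where
  "smooth_hol_section \<A> U A W \<Psi> \<longleftrightarrow>
     (\<forall>\<gamma>\<in>W. \<Psi> \<gamma> \<in> hol_fibre \<A> U A \<gamma>) \<and>
     (\<forall>\<alpha>. loop_smooth_on \<A> (W \<inter> loop_space \<A> (U \<alpha>)) (\<lambda>\<eta>. hol_coeff \<alpha> \<eta> (\<Psi> \<eta>)))"

text \<open>The covariant derivative of the section \<open>\<Psi>\<close> at \<open>\<gamma>\<close> along X: for every \<open>\<alpha>\<close> with \<open>\<gamma>\<close> in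
  \<open>LU\<^sub>\<alpha>\<close>, its coordinate in the basis \<open>\<sigma>\<^sub>\<alpha>\<close> is \<open>(d - \<tau>(B\<^sub>\<alpha>))\<close> applied to that of \<open>\<Psi>\<close>.\<close>

definition hol_nabla ::
    "('m::topological_space, 'e::euclidean_space) chart set \<Rightarrow> ('i \<Rightarrow> 'm set)
      \<Rightarrow> ('i \<Rightarrow> ('m, 'e) form) \<Rightarrow> ('m loop \<Rightarrow> ('i, 'm) hol_point)
      \<Rightarrow> 'm loop \<Rightarrow> ('m, 'e) loop_tvec \<Rightarrow> ('i, 'm) hol_point" where
  "hol_nabla \<A> U B \<Psi> \<gamma> X =
     {(\<alpha>, \<gamma>, loop_d \<A> (\<lambda>\<eta>. hol_coeff \<alpha> \<eta> (\<Psi> \<eta>)) \<gamma> X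
              - transgression \<A> (B \<alpha>) \<gamma> [X] * hol_coeff \<alpha> \<gamma> (\<Psi> \<gamma>)) | \<alpha>.
        \<gamma> \<in> loop_space \<A> (U \<alpha>)}"


section \<open>Line bundles with unitary connection\<close>

text \<open>A Hermitian line bundle over M with total space the type \<open>'l\<close>, its smooth structure given
  by local frames of unit length; addition in the fibres is determined by scalar multiplication,
  since the fibres are one-dimensional. The connection is given by its 1-forms
  \<open>a = potential (V, e)\<close>, where \<open>\<nabla>(f e) = (df + a f) e\<close> for the frame e over V.\<close>

record ('m, 'e, 'l) line_bundle =
  proj :: "'l \<Rightarrow> 'm"
  scale :: "complex \<Rightarrow> 'l \<Rightarrow> 'l"
  len :: "'l \<Rightarrow> real"
  frames :: "('m set \<times> ('m \<Rightarrow> 'l)) set"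
  potential :: "('m set \<times> ('m \<Rightarrow> 'l)) \<Rightarrow> ('m, 'e) form"

definition frame_coeff :: "('m, 'e, 'l) line_bundle \<Rightarrow> ('m \<Rightarrow> 'l) \<Rightarrow> 'l \<Rightarrow> complex" where
  "frame_coeff L e x = (THE z. x = scale L z (e (proj L x)))"

definition hermitian_line_bundle ::
    "('m::topological_space, 'e::euclidean_space) chart set \<Rightarrow> ('m, 'e, 'l) line_bundle \<Rightarrow> bool" where
  "hermitian_line_bundle \<A> L \<longleftrightarrow>
     (\<forall>x. scale L 1 x = x) \<and>
     (\<forall>z w x. scale L z (scale L w x) = scale L (z * w) x) \<and>
     (\<forall>z x. proj L (scale L z x) = proj L x) \<and>
     (\<forall>z x. len L (scale L z x) = cmod z * len L x) \<and>
     (\<Union>(V, e)\<in>frames L. V) = UNIV \<and>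
     (\<forall>(V, e)\<in>frames L. open V \<and> (\<forall>p\<in>V. proj L (e p) = p \<and> len L (e p) = 1 \<and>
        (\<forall>x. proj L x = p \<longrightarrow> (\<exists>!z. x = scale L z (e p))))) \<and>
     (\<forall>(V, e)\<in>frames L. \<forall>(V', e')\<in>frames L.
        smooth_fun \<A> (V \<inter> V') (\<lambda>p. frame_coeff L e (e' p)))"

definition unitary_connection ::
    "('m::topological_space, 'e::euclidean_space) chart set \<Rightarrow> ('m, 'e, 'l) line_bundle \<Rightarrow> bool" where
  "unitary_connection \<A> L \<longleftrightarrow>
     (\<forall>(V, e)\<in>frames L. is_form \<A> 1 V (potential L (V, e)) \<and>
        imaginary_form \<A> 1 V (potential L (V, e))) \<and>
     (\<forall>(V, e)\<in>frames L. \<forall>(V', e')\<in>frames L.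
        form_eq \<A> 1 (V \<inter> V') (potential L (V', e'))
          (\<lambda>p vs. potential L (V, e) p vs + dlog_form \<A> (\<lambda>q. frame_coeff L e (e' q)) p vs))"

text \<open>The curvature \<open>(\<nabla>\<^sup>L)\<^sup>2 = da\<close>, the same for all frames, and the action on B-fields.\<close>

definition curvature ::
    "('m, 'e::euclidean_space) chart set \<Rightarrow> ('m, 'e, 'l) line_bundle \<Rightarrow> ('m, 'e) form" where
  "curvature \<A> L p vs =
     (THE y. \<forall>(V, e)\<in>frames L. p \<in> V \<longrightarrow> y = ext_d \<A> (potential L (V, e)) p vs)"

definition pic_act ::
    "('m, 'e::euclidean_space) chart set \<Rightarrow> ('m, 'e, 'l) line_bundle
      \<Rightarrow> ('i \<Rightarrow> ('m, 'e) form) \<Rightarrow> ('i \<Rightarrow> ('m, 'e) form)" where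
  "pic_act \<A> L B = (\<lambda>\<alpha> p vs. B \<alpha> p vs + curvature \<A> L p vs)"

definition parallel_lift ::
    "('m::topological_space, 'e::euclidean_space) chart set \<Rightarrow> ('m, 'e, 'l) line_bundle
      \<Rightarrow> 'm loop \<Rightarrow> (real \<Rightarrow> 'l) \<Rightarrow> bool" where
  "parallel_lift \<A> L \<gamma> l \<longleftrightarrow>
     (\<forall>t\<in>{0..1}. proj L (l t) = \<gamma> t) \<and>
     (\<forall>(V, e)\<in>frames L. \<forall>t\<in>{0..1}. \<gamma> t \<in> V \<longrightarrow>
        ((\<lambda>r. frame_coeff L e (l r)) has_vector_derivative
           - potential L (V, e) (\<gamma> t) [push \<A> \<gamma> t 1] * frame_coeff L e (l t))
          (at t within {0..1}))"

text \<open>Sign convention: where \<open>\<nabla> = d + a\<close> along the loop, the holonomy is the exponential of the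
  integral of a. Parallel transport around the loop multiplies by \<open>exp (- \<integral>a)\<close>, so the holonomy
  is its inverse.\<close>

definition hol ::
    "('m::topological_space, 'e::euclidean_space) chart set \<Rightarrow> ('m, 'e, 'l) line_bundle
      \<Rightarrow> 'm loop \<Rightarrow> complex" where
  "hol \<A> L \<gamma> = (THE z. \<forall>l. parallel_lift \<A> L \<gamma> l \<longrightarrow> l 0 = scale L z (l 1))"

end

theory Submission
  imports Defs
begin

text \<open>Both connections act on the same local sections, and their 1-forms differ by the transgression
  of the curvature of L, so the claim is the first variation formula
  \<open>d ln hol = - \<tau>((\<nabla>\<^sup>L)\<^sup>2)\<close>. For a family f(t, s) of loops, in a unitary frame with potential a,
  parallel transport from s = v to s = u is the exponential of the integral of \<open>a(\<partial>\<^sub>s f)\<close> over [u, v],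
  and its logarithmic derivative in t is that integral of \<open>- da(\<partial>\<^sub>s f, \<partial>\<^sub>t f)\<close> plus the boundary term
  \<open>a(\<partial>\<^sub>t f)\<close> between u and v. Transition functions change the boundary terms by dlog, so these
  formulas concatenate across frames, and around a closed loop the boundary terms cancel.\<close>


section \<open>Calculus\<close>

text \<open>Several notions here are definite descriptions: \<open>ext_d\<close> ranges over charts,
  \<open>curvature\<close> over frames, \<open>hol\<close> over parallel lifts,
  \<open>loop_d\<close> over all curves with a given velocity. Much of the work is to show that they
  have exactly one value where they are evaluated. For \<open>hol\<close> this requires the
  existence of lifts, not just a relation between their ends; for \<open>loop_d\<close> of the
  holonomy it works because the variation integral depends on the curve only through the loop and
  its velocity. A second obstacle is that \<open>is_form\<close> grants smoothness only for values
  on constant coordinate vectors, so a form on varying velocities is expanded in a basis before it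
  is differentiated. Finally, a loop need not lie in one frame, and how far t may vary depends on
  the frames met. The local formula is therefore a statement about germs at t = 0, carried from
  short intervals to [0, 1] by bisection instead of an explicit subdivision.\<close>

lemma linear_Basis_expansion:
  fixes g :: "'a::euclidean_space \<Rightarrow> 'b::real_vector"
  assumes "linear g"
  shows "g u = (\<Sum>b\<in>Basis. (u \<bullet> b) *\<^sub>R g b)"
proof -
  have "g u = g (\<Sum>b\<in>Basis. (u \<bullet> b) *\<^sub>R b)"
    by (simp add: euclidean_representation)
  also have "\<dots> = (\<Sum>b\<in>Basis. (u \<bullet> b) *\<^sub>R g b)"
    by (simp add: linear_sum[OF assms] linear_scale[OF assms])
  finally show ?thesis .
qed

section \<open>Smooth maps between open sets of normed spaces\<close>

lemma smooth_on_open: "smooth_on S f \<Longrightarrow> open S"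
  by (simp add: smooth_on_def)

lemma smooth_on_continuous: "smooth_on S f \<Longrightarrow> continuous_on S f"
  unfolding smooth_on_def using ck_on.simps(1) by blast

lemma smooth_on_has_derivative:
  assumes "smooth_on S f" "x \<in> S"
  shows "(f has_derivative frechet_derivative f (at x)) (at x)"
proof -
  have "ck_on (Suc 0) S f" using assms(1) unfolding smooth_on_def by blast
  then show ?thesis using assms(2) by (simp add: frechet_derivative_works)
qed

lemma smooth_on_derivative:
  assumes "smooth_on S f"
  shows "smooth_on S (\<lambda>x. frechet_derivative f (at x) u)"
  unfolding smooth_on_def
proof (intro conjI allI)
  show "open S" using assms by (rule smooth_on_open)
  fix k
  have "ck_on (Suc k) S f" using assms unfolding smooth_on_def by blast
  then show "ck_on k S (\<lambda>x. frechet_derivative f (at x) u)" by simp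
qed

text \<open>Derivatives are taken in full neighbourhoods, so openness of \<open>S\<close> is what
  lets agreement on \<open>S\<close> pass to them.\<close>

lemma ck_on_cong:
  assumes "open S" "\<And>x. x \<in> S \<Longrightarrow> f x = h x" "ck_on k S f"
  shows "ck_on k S h"
  using assms(2,3)
proof (induction k arbitrary: f h)
  case 0
  then show ?case using continuous_on_cong[of S S f h] by auto
next
  case (Suc k)
  have diff: "\<forall>x\<in>S. h differentiable (at x)"
    using Suc.prems assms(1) has_derivative_transform_within_open
    unfolding ck_on.simps(2) differentiable_def by blast
  have eq: "frechet_derivative f (at x) u = frechet_derivative h (at x) u" if "x \<in> S" for x u
    using frechet_derivative_transform_within_open[of f x S h] Suc.prems that assms(1) by simp
  show ?case using diff Suc.IH[OF eq] Suc.prems(2) by auto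
qed

lemma ck_on_subset:
  "ck_on k S f \<Longrightarrow> T \<subseteq> S \<Longrightarrow> ck_on k T f"
  by (induction k arbitrary: f) (auto intro: continuous_on_subset)

lemma smooth_on_subset: "smooth_on S f \<Longrightarrow> open T \<Longrightarrow> T \<subseteq> S \<Longrightarrow> smooth_on T f"
  using ck_on_subset unfolding smooth_on_def by blast

text \<open>The linear part is constant, so a directional derivative of the composite is again a
  directional derivative of \<open>f\<close>, in direction \<open>l u\<close>, composed with the
  same affine map. The induction thus closes without a product rule.\<close>

lemma smooth_on_affine:
  assumes "smooth_on S f" "bounded_linear l"
  shows "smooth_on ((\<lambda>x. p + l x) -` S) (\<lambda>x. f (p + l x))"
proof -
  let ?T = "(\<lambda>x. p + l x) -` S"
  have cont: "continuous_on UNIV (\<lambda>x. p + l x)"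
    by (intro continuous_intros bounded_linear.continuous_on[OF assms(2)])
  have T: "open ?T"
    using open_vimage smooth_on_open[OF assms(1)] cont by blast
  have "ck_on k ?T (\<lambda>x. f (p + l x))" if "smooth_on S f" for k f
    using that
  proof (induction k arbitrary: f)
    case 0
    have "continuous_on ?T (\<lambda>x. f (p + l x))"
      by (rule continuous_on_compose2[OF smooth_on_continuous[OF 0]])
         (auto intro: continuous_on_subset[OF cont])
    then show ?case by simp
  next
    case (Suc k)
    have der: "((\<lambda>x. f (p + l x)) has_derivative
                 (\<lambda>u. frechet_derivative f (at (p + l x)) (l u))) (at x)" if "x \<in> ?T" for x
      by (rule has_derivative_compose[where f = "\<lambda>x. p + l x" and g = f and f' = l and s = UNIV])
         (use smooth_on_has_derivative[OF Suc.prems] that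
           bounded_linear_imp_has_derivative[OF assms(2)] in
           \<open>auto intro!: derivative_eq_intros\<close>)
    have "ck_on k ?T (\<lambda>x. frechet_derivative (\<lambda>x. f (p + l x)) (at x) u)" for u
      by (rule ck_on_cong[OF T _ Suc.IH[OF smooth_on_derivative[OF Suc.prems]]])
         (simp flip: frechet_derivative_at[OF der])
    then show ?case
      using der by (auto simp: differentiable_def)
  qed
  then show ?thesis using assms(1) T unfolding smooth_on_def by blast
qed

section \<open>Symmetry of second derivatives\<close>

lemma second_difference_mean_value:
  fixes f :: "'a::real_normed_vector \<Rightarrow> real"
  assumes f: "\<And>y. y \<in> S \<Longrightarrow> (f has_derivative f' y) (at y)"
    and fu: "\<And>y. y \<in> S \<Longrightarrow> ((\<lambda>y. f' y u) has_derivative fu' y) (at y)"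
    and r: "0 < r"
    and S: "\<And>a b. \<lbrakk>0 \<le> a; a \<le> r; 0 \<le> b; b \<le> r\<rbrakk> \<Longrightarrow> x + a *\<^sub>R u + b *\<^sub>R v \<in> S"
  obtains a b where "0 \<le> a" "a \<le> r" "0 \<le> b" "b \<le> r"
    "f (x + r *\<^sub>R u + r *\<^sub>R v) - f (x + r *\<^sub>R u) - f (x + r *\<^sub>R v) + f x
       = r * r * fu' (x + a *\<^sub>R u + b *\<^sub>R v) v"
proof -
  have line: "((\<lambda>a. F (p + a *\<^sub>R w)) has_real_derivative F' w) (at a)"
    if "(F has_derivative F') (at (p + a *\<^sub>R w))" for F :: "'a \<Rightarrow> real" and F' p w a
  proof -
    have "((\<lambda>a. p + a *\<^sub>R w) has_derivative (\<lambda>c. c *\<^sub>R w)) (at a)"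
      by (auto intro!: derivative_eq_intros)
    from has_derivative_compose[OF this, of F F'] that
    have "((\<lambda>a. F (p + a *\<^sub>R w)) has_derivative (\<lambda>c. F' (c *\<^sub>R w))) (at a)" by simp
    moreover have "F' (c *\<^sub>R w) = F' w * c" for c
      using linear_scale[OF has_derivative_linear[OF that]] by simp
    ultimately show ?thesis by (simp add: has_field_derivative_def)
  qed
  \<comment> \<open>The second difference is the increment in direction \<open>u\<close> of the
    function f(. + r v) - f. The mean value theorem is applied to it in direction \<open>u\<close>,
    and then to \<open>f' _ u\<close> in direction \<open>v\<close>.\<close>
  have "\<exists>a>0. a < r \<and>
      (f ((x + r *\<^sub>R v) + r *\<^sub>R u) - f (x + r *\<^sub>R u)) - (f ((x + r *\<^sub>R v) + 0 *\<^sub>R u) - f (x + 0 *\<^sub>R u))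
        = (r - 0) * (f' ((x + r *\<^sub>R v) + a *\<^sub>R u) u - f' (x + a *\<^sub>R u) u)"
  proof (rule MVT2[OF r])
    fix a assume a: "0 \<le> a" "a \<le> r"
    have "x + r *\<^sub>R v + a *\<^sub>R u \<in> S" "x + a *\<^sub>R u \<in> S"
      using S[OF a, of r] S[OF a, of 0] r by (simp_all add: algebra_simps)
    then show "((\<lambda>a. f ((x + r *\<^sub>R v) + a *\<^sub>R u) - f (x + a *\<^sub>R u)) has_real_derivative
        f' ((x + r *\<^sub>R v) + a *\<^sub>R u) u - f' (x + a *\<^sub>R u) u) (at a)"
      by (intro DERIV_diff line f)
  qed
  then obtain a where a: "0 < a" "a < r"
    "f (x + r *\<^sub>R u + r *\<^sub>R v) - f (x + r *\<^sub>R u) - f (x + r *\<^sub>R v) + f x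
       = r * (f' ((x + a *\<^sub>R u) + r *\<^sub>R v) u - f' ((x + a *\<^sub>R u) + 0 *\<^sub>R v) u)"
    by (auto simp: algebra_simps)
  have "\<exists>b>0. b < r \<and>
      f' ((x + a *\<^sub>R u) + r *\<^sub>R v) u - f' ((x + a *\<^sub>R u) + 0 *\<^sub>R v) u
        = (r - 0) * fu' ((x + a *\<^sub>R u) + b *\<^sub>R v) v"
    by (rule MVT2[OF r]) (use S a in \<open>intro line fu, auto\<close>)
  then show thesis using that a by (metis diff_zero less_imp_le mult.assoc)
qed

text \<open>The second difference is symmetric in \<open>u\<close> and \<open>v\<close>. Computed in
  the two orders it is r^2 times either mixed derivative at points close to \<open>x\<close>, and
  continuity forces the values at \<open>x\<close> to agree.\<close>

lemma symmetric_second_derivative_real: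
  fixes f :: "'a::real_normed_vector \<Rightarrow> real"
  assumes S: "open S" "x \<in> S"
    and f: "\<And>y. y \<in> S \<Longrightarrow> (f has_derivative f' y) (at y)"
    and fu: "\<And>y. y \<in> S \<Longrightarrow> ((\<lambda>y. f' y u) has_derivative fu' y) (at y)"
    and fv: "\<And>y. y \<in> S \<Longrightarrow> ((\<lambda>y. f' y v) has_derivative fv' y) (at y)"
    and cont: "continuous_on S (\<lambda>y. fu' y v)" "continuous_on S (\<lambda>y. fv' y u)"
  shows "fu' x v = fv' x u"
proof (rule ccontr)
  assume ne: "fu' x v \<noteq> fv' x u"
  \<comment> \<open>Half the gap: numbers within \<open>e\<close> of the two mixed derivatives at
    \<open>x\<close> cannot coincide.\<close>
  define e where "e = \<bar>fu' x v - fv' x u\<bar> / 2"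
  have e: "e > 0" using ne by (simp add: e_def)
  have near_x: "\<forall>\<^sub>F y in nhds x. dist (h y) (h x) < e" if "continuous_on S h" for h :: "'a \<Rightarrow> real"
  proof -
    have "isCont h x" using that S continuous_on_eq_continuous_at by blast
    then have "(h \<longlongrightarrow> h x) (nhds x)" by (simp add: continuous_at tendsto_at_iff_tendsto_nhds)
    then show ?thesis using e by (rule tendstoD)
  qed
  have "\<forall>\<^sub>F y in nhds x. y \<in> S" using S by (rule eventually_nhds_in_open)
  moreover have "\<forall>\<^sub>F y in nhds x. dist (fu' y v) (fu' x v) < e"
    by (rule near_x[OF cont(1)])
  moreover have "\<forall>\<^sub>F y in nhds x. dist (fv' y u) (fv' x u) < e"
    by (rule near_x[OF cont(2)])
  ultimately have "\<forall>\<^sub>F y in nhds x. y \<in> S \<and> dist (fu' y v) (fu' x v) < e \<and> dist (fv' y u) (fv' x u) < e"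
    by (simp add: eventually_conj)
  then obtain d where d: "d > 0" and near: "\<And>y. dist y x < d \<Longrightarrow>
      y \<in> S \<and> dist (fu' y v) (fu' x v) < e \<and> dist (fv' y u) (fv' x u) < e"
    unfolding eventually_nhds_metric by auto
  \<comment> \<open>Keeps the parallelogram at \<open>x\<close> with sides \<open>r u\<close> and
    \<open>r v\<close> inside the \<open>d\<close>-ball; the summand 1 makes the denominator
    positive even if \<open>u\<close> and \<open>v\<close> vanish.\<close>
  define r where "r = d / (norm u + norm v + 1)"
  have pos: "0 < norm u + norm v + 1" by (simp add: add_nonneg_pos)
  have r: "0 < r" using d pos by (simp add: r_def)
  have close: "dist (x + a *\<^sub>R u + b *\<^sub>R v) x < d" if "0 \<le> a" "a \<le> r" "0 \<le> b" "b \<le> r" for a b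
  proof -
    have "dist (x + a *\<^sub>R u + b *\<^sub>R v) x = norm (a *\<^sub>R u + b *\<^sub>R v)" by (simp add: dist_norm)
    also have "\<dots> \<le> a * norm u + b * norm v"
      by (rule norm_triangle_le) (use that in simp)
    also have "\<dots> \<le> r * norm u + r * norm v" by (intro add_mono mult_right_mono) (use that in auto)
    also have "\<dots> < r * (norm u + norm v + 1)" using r by (simp add: algebra_simps)
    also have "\<dots> = d" using pos by (simp add: r_def)
    finally show ?thesis .
  qed
  have close': "dist (x + a *\<^sub>R v + b *\<^sub>R u) x < d" if "0 \<le> a" "a \<le> r" "0 \<le> b" "b \<le> r" for a b
    using close[of b a] that by (simp add: algebra_simps)
  obtain a b where ab: "0 \<le> a" "a \<le> r" "0 \<le> b" "b \<le> r"
    "f (x + r *\<^sub>R u + r *\<^sub>R v) - f (x + r *\<^sub>R u) - f (x + r *\<^sub>R v) + f x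
       = r * r * fu' (x + a *\<^sub>R u + b *\<^sub>R v) v"
    using second_difference_mean_value[OF f fu r, where x = x and v = v] near close by blast
  obtain a' b' where ab': "0 \<le> a'" "a' \<le> r" "0 \<le> b'" "b' \<le> r"
    "f (x + r *\<^sub>R v + r *\<^sub>R u) - f (x + r *\<^sub>R v) - f (x + r *\<^sub>R u) + f x
       = r * r * fv' (x + a' *\<^sub>R v + b' *\<^sub>R u) u"
    using second_difference_mean_value[OF f fv r, where x = x and v = u] near close' by blast
  have "r * r * fu' (x + a *\<^sub>R u + b *\<^sub>R v) v = r * r * fv' (x + a' *\<^sub>R v + b' *\<^sub>R u) u"
    using ab(5) ab'(5) by (simp add: algebra_simps)
  then have "fu' (x + a *\<^sub>R u + b *\<^sub>R v) v = fv' (x + a' *\<^sub>R v + b' *\<^sub>R u) u"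
    using r by simp
  moreover have "dist (fu' (x + a *\<^sub>R u + b *\<^sub>R v) v) (fu' x v) < e"
    "dist (fv' (x + a' *\<^sub>R v + b' *\<^sub>R u) u) (fv' x u) < e"
    using near close close' ab ab' by blast+
  ultimately show False
    by (simp add: dist_real_def e_def)
       (smt (verit, best) field_sum_of_halves)
qed

text \<open>The mean value theorem is real-valued, so each component of \<open>f\<close> is treated
  separately.\<close>

lemma symmetric_second_derivative:
  fixes f :: "'a::real_normed_vector \<Rightarrow> 'b::euclidean_space"
  assumes f: "smooth_on S f" and x: "x \<in> S"
  shows "frechet_derivative (\<lambda>y. frechet_derivative f (at y) u) (at x) v
       = frechet_derivative (\<lambda>y. frechet_derivative f (at y) v) (at x) u"
proof (rule euclidean_eqI)
  fix b :: 'b assume "b \<in> Basis"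
  note D = smooth_on_has_derivative[OF f]
  note D2 = smooth_on_has_derivative[OF smooth_on_derivative[OF f]]
  note C2 = smooth_on_continuous[OF smooth_on_derivative[OF smooth_on_derivative[OF f]]]
  show "frechet_derivative (\<lambda>y. frechet_derivative f (at y) u) (at x) v \<bullet> b
      = frechet_derivative (\<lambda>y. frechet_derivative f (at y) v) (at x) u \<bullet> b"
    by (rule symmetric_second_derivative_real[OF smooth_on_open[OF f] x,
          where f = "\<lambda>y. f y \<bullet> b" and f' = "\<lambda>y w. frechet_derivative f (at y) w \<bullet> b"
            and fu' = "\<lambda>y w. frechet_derivative (\<lambda>y. frechet_derivative f (at y) u) (at y) w \<bullet> b"
            and fv' = "\<lambda>y w. frechet_derivative (\<lambda>y. frechet_derivative f (at y) v) (at y) w \<bullet> b"])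
       (intro has_derivative_inner_left D D2 continuous_on_inner C2 continuous_on_const; assumption)+
qed

section \<open>Pullback of one-forms between open sets\<close>

lemma pullback_one_form:
  fixes \<phi> :: "'a::real_normed_vector \<Rightarrow> 'e::euclidean_space" and \<theta> :: "'e \<Rightarrow> 'e \<Rightarrow> 'c::real_normed_vector"
  assumes \<phi>: "smooth_on S \<phi>" and sub: "\<phi> ` S \<subseteq> T"
    and \<theta>: "\<And>u. smooth_on T (\<lambda>y. \<theta> y u)" and lin: "\<And>y. y \<in> T \<Longrightarrow> linear (\<theta> y)"
  defines "D u x w \<equiv> \<theta> (\<phi> x) (frechet_derivative (\<lambda>x. frechet_derivative \<phi> (at x) u) (at x) w)
     + frechet_derivative (\<lambda>y. \<theta> y (frechet_derivative \<phi> (at x) u)) (at (\<phi> x)) (frechet_derivative \<phi> (at x) w)"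
  shows "x \<in> S \<Longrightarrow> ((\<lambda>x. \<theta> (\<phi> x) (frechet_derivative \<phi> (at x) u)) has_derivative D u x) (at x)"
    and "continuous_on S (\<lambda>x. D u x w)"
proof -
  note D\<phi> = smooth_on_has_derivative[OF \<phi>]
  note D2\<phi> = smooth_on_has_derivative[OF smooth_on_derivative[OF \<phi>]]
  note D\<theta> = smooth_on_has_derivative[OF \<theta>]
  have T: "open T" using smooth_on_open[OF \<theta>] .
  \<comment> \<open>Linearity in \<open>u\<close> holds on the whole open set \<open>T\<close>, so
    it survives differentiation in \<open>y\<close>.\<close>
  have lin2: "frechet_derivative (\<lambda>y. \<theta> y u) (at y) w
      = (\<Sum>b\<in>Basis. (u \<bullet> b) *\<^sub>R frechet_derivative (\<lambda>y. \<theta> y b) (at y) w)" if "y \<in> T" for y u w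
  proof -
    have "((\<lambda>y. \<Sum>b\<in>Basis. (u \<bullet> b) *\<^sub>R \<theta> y b) has_derivative
        (\<lambda>w. \<Sum>b\<in>Basis. (u \<bullet> b) *\<^sub>R frechet_derivative (\<lambda>y. \<theta> y b) (at y) w)) (at y)"
      by (intro derivative_intros D\<theta> that)
    then have "((\<lambda>y. \<theta> y u) has_derivative
        (\<lambda>w. \<Sum>b\<in>Basis. (u \<bullet> b) *\<^sub>R frechet_derivative (\<lambda>y. \<theta> y b) (at y) w)) (at y)"
      by (rule has_derivative_transform_within_open[OF _ T that])
         (simp add: linear_Basis_expansion[OF lin, symmetric])
    from frechet_derivative_at[OF this] show ?thesis by metis
  qed
  \<comment> \<open>The product rule with the varying vectors moved into scalar coefficients:
    \<open>\<theta>\<close> now meets only the constant basis vectors \<open>b\<close>, where its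
    smoothness is known.\<close>
  have D_expand: "D u x w = (\<Sum>b\<in>Basis.
      (frechet_derivative (\<lambda>x. frechet_derivative \<phi> (at x) u) (at x) w \<bullet> b) *\<^sub>R \<theta> (\<phi> x) b +
      (frechet_derivative \<phi> (at x) u \<bullet> b) *\<^sub>R
        frechet_derivative (\<lambda>y. \<theta> y b) (at (\<phi> x)) (frechet_derivative \<phi> (at x) w))"
    if "x \<in> S" for u x w
  proof -
    have xT: "\<phi> x \<in> T" using sub that by blast
    show ?thesis
      unfolding D_def lin2[OF xT, of "frechet_derivative \<phi> (at x) u"] sum.distrib
      by (simp add: linear_Basis_expansion[OF lin[OF xT], symmetric])
  qed
  show "((\<lambda>x. \<theta> (\<phi> x) (frechet_derivative \<phi> (at x) u)) has_derivative D u x) (at x)" if x: "x \<in> S"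
  proof -
    have comp: "((\<lambda>x. \<theta> (\<phi> x) b) has_derivative
        (\<lambda>w. frechet_derivative (\<lambda>y. \<theta> y b) (at (\<phi> x)) (frechet_derivative \<phi> (at x) w))) (at x)" for b
      by (rule has_derivative_compose[OF D\<phi>[OF x] D\<theta>]) (use sub x in blast)
    have "((\<lambda>x. \<Sum>b\<in>Basis. (frechet_derivative \<phi> (at x) u \<bullet> b) *\<^sub>R \<theta> (\<phi> x) b) has_derivative
       (\<lambda>w. \<Sum>b\<in>Basis. (frechet_derivative \<phi> (at x) u \<bullet> b) *\<^sub>R
          frechet_derivative (\<lambda>y. \<theta> y b) (at (\<phi> x)) (frechet_derivative \<phi> (at x) w)
        + (frechet_derivative (\<lambda>x. frechet_derivative \<phi> (at x) u) (at x) w \<bullet> b) *\<^sub>R \<theta> (\<phi> x) b)) (at x)"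
      by (intro has_derivative_sum has_derivative_scaleR has_derivative_inner_left comp D2\<phi>[OF x])
    also have "(\<lambda>w. \<Sum>b\<in>Basis. (frechet_derivative \<phi> (at x) u \<bullet> b) *\<^sub>R
          frechet_derivative (\<lambda>y. \<theta> y b) (at (\<phi> x)) (frechet_derivative \<phi> (at x) w)
        + (frechet_derivative (\<lambda>x. frechet_derivative \<phi> (at x) u) (at x) w \<bullet> b) *\<^sub>R \<theta> (\<phi> x) b) = D u x"
      by (rule ext) (simp add: D_expand[OF x] add.commute)
    finally show ?thesis
      by (rule has_derivative_transform_within_open[OF _ smooth_on_open[OF \<phi>] x])
         (metis image_subset_iff lin linear_Basis_expansion sub)
  qed
  \<comment> \<open>The direction in which \<open>\<theta>\<close> is differentiated varies with x
    as well, hence a second expansion over \<open>b'\<close>.\<close>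
  have "continuous_on S (\<lambda>x. \<Sum>b\<in>Basis.
      (frechet_derivative (\<lambda>x. frechet_derivative \<phi> (at x) u) (at x) w \<bullet> b) *\<^sub>R \<theta> (\<phi> x) b +
      (frechet_derivative \<phi> (at x) u \<bullet> b) *\<^sub>R (\<Sum>b'\<in>Basis. (frechet_derivative \<phi> (at x) w \<bullet> b') *\<^sub>R
        frechet_derivative (\<lambda>y. \<theta> y b) (at (\<phi> x)) b'))"
    by (intro continuous_intros smooth_on_continuous[OF smooth_on_derivative[OF \<phi>]]
        smooth_on_continuous[OF smooth_on_derivative[OF smooth_on_derivative[OF \<phi>]]]
        continuous_on_compose2[OF smooth_on_continuous[OF \<theta>] smooth_on_continuous[OF \<phi>] sub]
        continuous_on_compose2[OF smooth_on_continuous[OF smooth_on_derivative[OF \<theta>]]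
          smooth_on_continuous[OF \<phi>] sub])
  then show "continuous_on S (\<lambda>x. D u x w)"
  proof (rule continuous_on_eq)
    fix x assume x: "x \<in> S"
    then have xT: "\<phi> x \<in> T" using sub by blast
    have "(\<Sum>b'\<in>Basis. (frechet_derivative \<phi> (at x) w \<bullet> b') *\<^sub>R
        frechet_derivative (\<lambda>y. \<theta> y b) (at (\<phi> x)) b')
      = frechet_derivative (\<lambda>y. \<theta> y b) (at (\<phi> x)) (frechet_derivative \<phi> (at x) w)" for b
      by (rule linear_Basis_expansion[symmetric]) (rule has_derivative_linear[OF D\<theta>[OF xT]])
    then show "(\<Sum>b\<in>Basis.
      (frechet_derivative (\<lambda>x. frechet_derivative \<phi> (at x) u) (at x) w \<bullet> b) *\<^sub>R \<theta> (\<phi> x) b +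
      (frechet_derivative \<phi> (at x) u \<bullet> b) *\<^sub>R (\<Sum>b'\<in>Basis. (frechet_derivative \<phi> (at x) w \<bullet> b') *\<^sub>R
        frechet_derivative (\<lambda>y. \<theta> y b) (at (\<phi> x)) b')) = D u x w"
      by (simp only: D_expand[OF x])
  qed
qed

text \<open>The exterior derivative commutes with pullback: the terms in which
  \<open>\<theta>\<close> is applied to a second derivative of \<open>\<phi>\<close> cancel by
  symmetry.\<close>

lemma pullback_one_form_antisym:
  fixes \<phi> :: "'a::real_normed_vector \<Rightarrow> 'e::euclidean_space" and \<theta> :: "'e \<Rightarrow> 'e \<Rightarrow> 'c::real_normed_vector"
  assumes \<phi>: "smooth_on S \<phi>" and sub: "\<phi> ` S \<subseteq> T"
    and \<theta>: "\<And>u. smooth_on T (\<lambda>y. \<theta> y u)" and lin: "\<And>y. y \<in> T \<Longrightarrow> linear (\<theta> y)"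
    and x: "x \<in> S"
  shows "frechet_derivative (\<lambda>x. \<theta> (\<phi> x) (frechet_derivative \<phi> (at x) u)) (at x) w
       - frechet_derivative (\<lambda>x. \<theta> (\<phi> x) (frechet_derivative \<phi> (at x) w)) (at x) u
       = frechet_derivative (\<lambda>y. \<theta> y (frechet_derivative \<phi> (at x) u)) (at (\<phi> x)) (frechet_derivative \<phi> (at x) w)
       - frechet_derivative (\<lambda>y. \<theta> y (frechet_derivative \<phi> (at x) w)) (at (\<phi> x)) (frechet_derivative \<phi> (at x) u)"
proof -
  have "frechet_derivative (\<lambda>x. \<theta> (\<phi> x) (frechet_derivative \<phi> (at x) u)) (at x) w =
      \<theta> (\<phi> x) (frechet_derivative (\<lambda>x. frechet_derivative \<phi> (at x) u) (at x) w) +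
      frechet_derivative (\<lambda>y. \<theta> y (frechet_derivative \<phi> (at x) u)) (at (\<phi> x)) (frechet_derivative \<phi> (at x) w)"
    for u w
    using fun_cong[OF frechet_derivative_at[OF pullback_one_form(1)[OF \<phi> sub \<theta> lin x, of u]], of w] by simp
  then show ?thesis
    by (simp add: symmetric_second_derivative[OF \<phi> x, of u w])
qed

section \<open>Derivatives along lines and on closed intervals\<close>

lemma has_derivative_imp_has_vector_derivative:
  assumes "(f has_derivative D) F"
  shows "(f has_vector_derivative D 1) F"
proof -
  have "D x = x *\<^sub>R D 1" for x
    using linear_scale[OF has_derivative_linear[OF assms], of x 1] by simp
  then show ?thesis
    unfolding has_vector_derivative_def by (intro has_derivative_eq_rhs[OF assms] ext)
qed

lemma partial_derivatives:
  assumes "(h has_derivative D) (at (t, s))"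
  shows "((\<lambda>t. h (t, s)) has_vector_derivative D (1, 0)) (at t within T)"
    and "((\<lambda>s. h (t, s)) has_vector_derivative D (0, 1)) (at s within T')"
proof -
  have "((\<lambda>t. (t, s)) has_derivative (\<lambda>u. (u, 0))) (at t)" "((\<lambda>s. (t, s)) has_derivative (\<lambda>u. (0, u))) (at s)"
    by (auto intro!: derivative_eq_intros)
  then have "((\<lambda>t. h (t, s)) has_derivative (\<lambda>u. D (u, 0))) (at t)"
    "((\<lambda>s. h (t, s)) has_derivative (\<lambda>u. D (0, u))) (at s)"
    using assms by (auto intro: has_derivative_compose)
  then show "((\<lambda>t. h (t, s)) has_vector_derivative D (1, 0)) (at t within T)"
    "((\<lambda>s. h (t, s)) has_vector_derivative D (0, 1)) (at s within T')"
    by (auto dest: has_derivative_imp_has_vector_derivative intro: has_vector_derivative_at_within)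
qed

lemma has_vector_derivative_within_Un:
  assumes "(f has_vector_derivative D) (at x within S)" "(f has_vector_derivative D) (at x within T)"
  shows "(f has_vector_derivative D) (at x within (S \<union> T))"
  using assms unfolding has_vector_derivative_def has_derivative_within
  by (auto simp: at_within_union intro: filterlim_sup)

lemma has_vector_derivative_bot: "(f has_vector_derivative D) bot"
  unfolding has_vector_derivative_def has_derivative_def
  using bounded_linear_scaleR_left[of D] by simp


section \<open>One-forms and smooth maps into a manifold\<close>

definition coord_form ::
    "('m, 'e::euclidean_space) chart set \<Rightarrow> ('m, 'e) chart \<Rightarrow> ('m, 'e) form \<Rightarrow> 'e \<Rightarrow> 'e \<Rightarrow> complex"
where
  "coord_form \<A> c \<omega> y u = \<omega> (chart_inv c y) [coord_vec \<A> c (chart_inv c y) u]"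

lemma ext_d_in_one_form:
  "ext_d_in \<A> c \<omega> p [v, w] =
     frechet_derivative (\<lambda>y. coord_form \<A> c \<omega> y (w c)) (at (snd c p)) (v c) -
     frechet_derivative (\<lambda>y. coord_form \<A> c \<omega> y (v c)) (at (snd c p)) (w c)"
  by (simp add: ext_d_in_def coord_form_def numeral_2_eq_2)

lemma smooth_into_continuous: "smooth_into \<A> S f \<Longrightarrow> continuous_on S f"
  by (simp add: smooth_into_def)

lemma smooth_into_open_vimage:
  assumes "smooth_into \<A> S f" "open V"
  shows "open (S \<inter> f -` V)"
  using assms continuous_on_open_vimage[of S f] by (auto simp: smooth_into_def Int_commute)

lemma smooth_into_coord:
  assumes "smooth_into \<A> S f" "c \<in> \<A>"
  shows "smooth_on (S \<inter> f -` fst c) (snd c \<circ> f)"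
  using assms by (simp add: smooth_into_def)

lemma is_form_coord_smooth:
  assumes "is_form \<A> k V \<omega>" "c \<in> \<A>" "length us = k"
  shows "smooth_on (snd c ` (fst c \<inter> V))
           (\<lambda>y. \<omega> (chart_inv c y) (map (coord_vec \<A> c (chart_inv c y)) us))"
  using assms by (auto simp: is_form_def)

lemma coord_form_smooth:
  assumes "is_form \<A> 1 V \<omega>" "c \<in> \<A>"
  shows "smooth_on (snd c ` (fst c \<inter> V)) (\<lambda>y. coord_form \<A> c \<omega> y u)"
  using is_form_coord_smooth[OF assms, of "[u]"] by (simp add: coord_form_def)

context
  fixes \<A> :: "('m::{t2_space,second_countable_topology}, 'e::euclidean_space) chart set"
  assumes atlas: "smooth_atlas \<A>"
begin

section \<open>Charts, pushforwards and tangent vectors\<close>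

lemma chart_at: obtains c where "c \<in> \<A>" "p \<in> fst c"
  using atlas unfolding smooth_atlas_def by blast

lemma chart_homeomorphism:
  "c \<in> \<A> \<Longrightarrow> homeomorphism (fst c) (snd c ` fst c) (snd c) (chart_inv c)"
  using atlas unfolding smooth_atlas_def by blast

lemma chart_inv_left: "c \<in> \<A> \<Longrightarrow> p \<in> fst c \<Longrightarrow> chart_inv c (snd c p) = p"
  using chart_homeomorphism by (simp add: homeomorphism_def)

lemma open_chart: "c \<in> \<A> \<Longrightarrow> open (fst c)"
  using atlas unfolding smooth_atlas_def by blast

lemma transition_smooth:
  "c \<in> \<A> \<Longrightarrow> d \<in> \<A> \<Longrightarrow> smooth_on (snd c ` (fst c \<inter> fst d)) (snd d \<circ> chart_inv c)"
  using atlas unfolding smooth_atlas_def by blast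

lemma transition_has_derivative:
  assumes "c \<in> \<A>" "d \<in> \<A>" "p \<in> fst c" "p \<in> fst d"
  shows "(snd d \<circ> chart_inv c has_derivative
            frechet_derivative (snd d \<circ> chart_inv c) (at (snd c p))) (at (snd c p))"
  by (rule smooth_on_has_derivative[OF transition_smooth]) (use assms in auto)

lemma chart_inv_smooth_into:
  assumes c: "c \<in> \<A>"
  shows "smooth_into \<A> (snd c ` fst c) (chart_inv c)"
  unfolding smooth_into_def
proof (intro conjI ballI)
  show "open (snd c ` fst c)" using atlas c unfolding smooth_atlas_def by blast
  show "continuous_on (snd c ` fst c) (chart_inv c)"
    using chart_homeomorphism[OF c] by (simp add: homeomorphism_def)
  fix d assume d: "d \<in> \<A>"
  have "snd c ` fst c \<inter> chart_inv c -` fst d = snd c ` (fst c \<inter> fst d)"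
    using chart_inv_left[OF c] by auto
  then show "smooth_on (snd c ` fst c \<inter> chart_inv c -` fst d) (snd d \<circ> chart_inv c)"
    using transition_smooth[OF c d] by simp
qed

lemma smooth_into_coord_has_derivative:
  assumes "smooth_into \<A> S f" "x \<in> S" "c \<in> \<A>" "f x \<in> fst c"
  shows "(snd c \<circ> f has_derivative (\<lambda>u. push \<A> f x u c)) (at x)"
proof -
  have "(snd c \<circ> f has_derivative frechet_derivative (snd c \<circ> f) (at x)) (at x)"
    by (rule smooth_on_has_derivative[OF smooth_into_coord[OF assms(1,3)]]) (use assms in auto)
  then show ?thesis using assms by (simp add: push_def)
qed

text \<open>Chain rule for the coordinate change after \<open>snd c \<circ> f\<close>. The composite
  agrees with \<open>snd d \<circ> f\<close> where \<open>f\<close> lies in the chart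
  \<open>c\<close>; this set is open, which suffices for derivatives.\<close>

lemma push_change:
  assumes f: "smooth_into \<A> S f" "x \<in> S" and c: "c \<in> \<A>" "f x \<in> fst c" and d: "d \<in> \<A>" "f x \<in> fst d"
  shows "push \<A> f x u d
    = frechet_derivative (snd d \<circ> chart_inv c) (at (snd c (f x))) (push \<A> f x u c)"
proof -
  have "((snd d \<circ> chart_inv c) \<circ> (snd c \<circ> f) has_derivative
      frechet_derivative (snd d \<circ> chart_inv c) (at (snd c (f x))) \<circ> (\<lambda>u. push \<A> f x u c)) (at x)"
    by (rule diff_chain_at[OF smooth_into_coord_has_derivative[OF f c]])
       (use transition_has_derivative[OF c(1) d(1) c(2) d(2)] in simp)
  then have "(snd d \<circ> f has_derivative
      frechet_derivative (snd d \<circ> chart_inv c) (at (snd c (f x))) \<circ> (\<lambda>u. push \<A> f x u c)) (at x)"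
    by (rule has_derivative_transform_within_open[OF _ smooth_into_open_vimage[OF f(1) open_chart[OF c(1)]]])
       (use f c chart_inv_left[OF c(1)] in auto)
  from has_derivative_unique[OF this smooth_into_coord_has_derivative[OF f d]]
  show ?thesis by (simp add: fun_eq_iff)
qed

lemma push_tangent:
  assumes "smooth_into \<A> S f" "x \<in> S"
  shows "push \<A> f x u \<in> tangent_space \<A> (f x)"
  unfolding tangent_space_def
proof (intro CollectI conjI ballI allI impI)
  fix c d assume "c \<in> \<A>" "d \<in> \<A>" "f x \<in> fst c \<and> f x \<in> fst d"
  then show "push \<A> f x u d
      = frechet_derivative (snd d \<circ> chart_inv c) (at (snd c (f x))) (push \<A> f x u c)"
    by (intro push_change[OF assms]) auto
qed (auto simp: push_def)

lemma coord_vec_tangent: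
  assumes "c \<in> \<A>" "p \<in> fst c"
  shows "coord_vec \<A> c p u \<in> tangent_space \<A> p"
  using push_tangent[OF chart_inv_smooth_into[OF assms(1)], of "snd c p"] assms
  by (simp add: coord_vec_def chart_inv_left)

text \<open>The Jacobians recover a tangent vector from its entry at one chart. The convention that
  entries at all other charts vanish makes this an equality of functions.\<close>

lemma coord_vec_tangent_vector:
  assumes v: "v \<in> tangent_space \<A> p" and c: "c \<in> \<A>" "p \<in> fst c"
  shows "coord_vec \<A> c p (v c) = v"
proof
  fix d
  show "coord_vec \<A> c p (v c) d = v d"
  proof (cases "d \<in> \<A> \<and> p \<in> fst d")
    case True
    then have "v d = frechet_derivative (snd d \<circ> chart_inv c) (at (snd c p)) (v c)"
      using v c unfolding tangent_space_def by blast
    with True c show ?thesis by (simp only: coord_vec_def push_def chart_inv_left if_True simp_thms)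
  next
    case False
    then have "v d = 0" using v unfolding tangent_space_def by blast
    with False c show ?thesis by (simp only: coord_vec_def push_def chart_inv_left if_False simp_thms)
  qed
qed

lemma coord_vec_linear:
  assumes c: "c \<in> \<A>" "p \<in> fst c"
  shows "coord_vec \<A> c p (a *\<^sub>R u + b *\<^sub>R w)
    = (\<lambda>d. a *\<^sub>R coord_vec \<A> c p u d + b *\<^sub>R coord_vec \<A> c p w d)"
proof
  fix d
  show "coord_vec \<A> c p (a *\<^sub>R u + b *\<^sub>R w) d
    = a *\<^sub>R coord_vec \<A> c p u d + b *\<^sub>R coord_vec \<A> c p w d"
  proof (cases "d \<in> \<A> \<and> p \<in> fst d")
    case True
    have lin: "linear (frechet_derivative (snd d \<circ> chart_inv c) (at (snd c p)))"
      by (rule has_derivative_linear[OF transition_has_derivative]) (use c True in auto)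
    show ?thesis
      using True c by (simp add: coord_vec_def push_def chart_inv_left linear_add[OF lin] linear_scale[OF lin])
  next
    case False
    then show ?thesis using c by (auto simp: coord_vec_def push_def chart_inv_left)
  qed
qed

section \<open>Forms evaluated on pushforwards\<close>

lemma is_form_linear_slot:
  assumes \<omega>: "is_form \<A> k V \<omega>" and p: "p \<in> V" and c: "c \<in> \<A>" "p \<in> fst c"
    and vs: "vs \<in> tangent_lists \<A> k p" and i: "i < k"
  shows "linear (\<lambda>u. \<omega> p (vs[i := coord_vec \<A> c p u]))"
proof -
  have add: "\<omega> p (vs[i := coord_vec \<A> c p (a *\<^sub>R u + b *\<^sub>R w)])
      = of_real a * \<omega> p (vs[i := coord_vec \<A> c p u]) + of_real b * \<omega> p (vs[i := coord_vec \<A> c p w])"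
    for a b u w
  proof -
    have slot: "\<forall>v\<in>tangent_space \<A> p. \<forall>w\<in>tangent_space \<A> p. \<forall>a b :: real.
        \<omega> p (vs[i := \<lambda>d. a *\<^sub>R v d + b *\<^sub>R w d])
          = of_real a * \<omega> p (vs[i := v]) + of_real b * \<omega> p (vs[i := w])"
      using \<omega> p vs i unfolding is_form_def by simp
    show ?thesis
      unfolding coord_vec_linear[OF c] by (rule slot[rule_format]) (rule coord_vec_tangent[OF c])+
  qed
  show ?thesis
    using add[of 1 _ 1] add[of _ _ 0] by (intro linearI) (auto simp: scaleR_conv_of_real)
qed

lemma coord_form_linear:
  assumes \<omega>: "is_form \<A> 1 V \<omega>" and c: "c \<in> \<A>" and y: "y \<in> snd c ` (fst c \<inter> V)"
  shows "linear (coord_form \<A> c \<omega> y)"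
proof -
  let ?p = "chart_inv c y"
  have p: "?p \<in> V" "?p \<in> fst c" using y chart_inv_left[OF c] by auto
  have "linear (\<lambda>u. \<omega> ?p ([coord_vec \<A> c ?p 0][0 := coord_vec \<A> c ?p u]))"
    by (rule is_form_linear_slot[OF \<omega> p(1) c p(2)])
       (use coord_vec_tangent[OF c p(2)] in \<open>auto simp: tangent_lists_def\<close>)
  then show ?thesis by (simp add: coord_form_def[abs_def])
qed

text \<open>Brings a form along \<open>f\<close> into the shape required by
  \<open>pullback_one_form\<close>, with \<open>\<theta>\<close> the form and \<open>\<phi>\<close>
  the map \<open>f\<close> in the chart \<open>c\<close>.\<close>

lemma one_form_push:
  assumes f: "smooth_into \<A> S f" "x \<in> S" and c: "c \<in> \<A>" "f x \<in> fst c"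
  shows "\<omega> (f x) [push \<A> f x u]
    = coord_form \<A> c \<omega> ((snd c \<circ> f) x) (frechet_derivative (snd c \<circ> f) (at x) u)"
proof -
  have "frechet_derivative (snd c \<circ> f) (at x) u = push \<A> f x u c"
    using c by (simp add: push_def)
  then show ?thesis
    using coord_vec_tangent_vector[OF push_tangent[OF f] c] c
    by (simp add: coord_form_def chart_inv_left)
qed

text \<open>Serves to integrate the curving along loops. In a chart the value is a double basis sum
  of smooth coefficients times continuous velocity components.\<close>

lemma two_form_push_continuous:
  assumes \<omega>: "is_form \<A> 2 V \<omega>" and V: "open V" and f: "smooth_into \<A> S f" and x: "x \<in> S" "f x \<in> V"
  shows "isCont (\<lambda>x. \<omega> (f x) [push \<A> f x u, push \<A> f x w]) x"
proof -
  obtain c where c: "c \<in> \<A>" "f x \<in> fst c" by (rule chart_at)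
  define S' where "S' = S \<inter> f -` (fst c \<inter> V)"
  have S': "open S'" unfolding S'_def
    by (intro smooth_into_open_vimage[OF f] open_Int open_chart c V)
  have xS': "x \<in> S'" using x c by (simp add: S'_def)
  define \<phi> where "\<phi> = snd c \<circ> f"
  have \<phi>: "smooth_on S' \<phi>" unfolding \<phi>_def
    by (rule smooth_on_subset[OF smooth_into_coord[OF f c(1)] S']) (auto simp: S'_def)
  have \<phi>_sub: "\<phi> ` S' \<subseteq> snd c ` (fst c \<inter> V)" by (auto simp: S'_def \<phi>_def)
  define \<theta> where "\<theta> y b b' = \<omega> (chart_inv c y) [coord_vec \<A> c (chart_inv c y) b, coord_vec \<A> c (chart_inv c y) b']"
    for y b b'
  have \<theta>: "smooth_on (snd c ` (fst c \<inter> V)) (\<lambda>y. \<theta> y b b')" for b b'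
    using is_form_coord_smooth[OF \<omega> c(1), of "[b, b']"] by (simp add: \<theta>_def)
  have "continuous_on S' (\<lambda>x. \<Sum>b\<in>Basis. (frechet_derivative \<phi> (at x) u \<bullet> b) *\<^sub>R
      (\<Sum>b'\<in>Basis. (frechet_derivative \<phi> (at x) w \<bullet> b') *\<^sub>R \<theta> (\<phi> x) b b'))"
    by (intro continuous_intros smooth_on_continuous[OF smooth_on_derivative[OF \<phi>]]
        continuous_on_compose2[OF smooth_on_continuous[OF \<theta>] smooth_on_continuous[OF \<phi>] \<phi>_sub])
  then have "continuous_on S' (\<lambda>x. \<omega> (f x) [push \<A> f x u, push \<A> f x w])"
  proof (rule continuous_on_eq)
    fix x assume "x \<in> S'"
    then have x: "x \<in> S" "f x \<in> V" "f x \<in> fst c" by (auto simp: S'_def)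
    note pt = push_tangent[OF f x(1)]
    have \<theta>_eq: "\<theta> (\<phi> x) b b' = \<omega> (f x) [coord_vec \<A> c (f x) b, coord_vec \<A> c (f x) b']" for b b'
      using c x by (simp add: \<theta>_def \<phi>_def chart_inv_left)
    have push: "push \<A> f x v = coord_vec \<A> c (f x) (frechet_derivative \<phi> (at x) v)" for v
      using coord_vec_tangent_vector[OF pt c(1) x(3), of v] c x by (simp add: push_def \<phi>_def)
    have "linear (\<lambda>z. \<omega> (f x) ([coord_vec \<A> c (f x) b, coord_vec \<A> c (f x) 0][1 := coord_vec \<A> c (f x) z]))" for b
      by (rule is_form_linear_slot[OF \<omega> x(2) c(1) x(3)])
         (use coord_vec_tangent[OF c(1) x(3)] in \<open>auto simp: tangent_lists_def\<close>)
    then have l2: "linear (\<lambda>z. \<omega> (f x) [coord_vec \<A> c (f x) b, coord_vec \<A> c (f x) z])" for b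
      by simp
    have "linear (\<lambda>z. \<omega> (f x) ([coord_vec \<A> c (f x) 0, push \<A> f x w][0 := coord_vec \<A> c (f x) z]))"
      by (rule is_form_linear_slot[OF \<omega> x(2) c(1) x(3)])
         (use coord_vec_tangent[OF c(1) x(3)] pt in \<open>auto simp: tangent_lists_def\<close>)
    then have l1: "linear (\<lambda>z. \<omega> (f x) [coord_vec \<A> c (f x) z, push \<A> f x w])"
      by simp
    show "(\<Sum>b\<in>Basis. (frechet_derivative \<phi> (at x) u \<bullet> b) *\<^sub>R
        (\<Sum>b'\<in>Basis. (frechet_derivative \<phi> (at x) w \<bullet> b') *\<^sub>R \<theta> (\<phi> x) b b'))
      = \<omega> (f x) [push \<A> f x u, push \<A> f x w]"
      \<comment> \<open>The inner sum is contracted first: linearity in the first slot,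
        \<open>l1\<close>, is stated with \<open>push \<A> f x w\<close> already in the
        second.\<close>
      unfolding \<theta>_eq linear_Basis_expansion[OF l2, symmetric] push[of w, symmetric]
      unfolding linear_Basis_expansion[OF l1, symmetric] push[of u, symmetric] ..
  qed
  then show ?thesis
    using S' xS' by (simp add: continuous_on_eq_continuous_at)
qed

text \<open>Transfers the coordinate calculus to the manifold, locally at \<open>x\<close>. The last
  conclusion is Cartan's formula for the pulled back form on the constant fields \<open>w\<close>
  and \<open>u\<close>; these commute, so there is no bracket term.\<close>

lemma one_form_pullback:
  assumes \<omega>: "is_form \<A> 1 V \<omega>" and V: "open V" and f: "smooth_into \<A> S f" and x: "x \<in> S" "f x \<in> V"
  defines "h \<equiv> \<lambda>u x. \<omega> (f x) [push \<A> f x u]"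
  shows "(h u has_derivative frechet_derivative (h u) (at x)) (at x)"
    and "isCont (\<lambda>x. frechet_derivative (h u) (at x) w) x"
    and "c \<in> \<A> \<Longrightarrow> f x \<in> fst c \<Longrightarrow> ext_d_in \<A> c \<omega> (f x) [push \<A> f x w, push \<A> f x u]
       = frechet_derivative (h u) (at x) w - frechet_derivative (h w) (at x) u"
proof -
  have *: "(h u has_derivative frechet_derivative (h u) (at x)) (at x) \<and>
      isCont (\<lambda>x. frechet_derivative (h u) (at x) w) x \<and>
      ext_d_in \<A> c \<omega> (f x) [push \<A> f x w, push \<A> f x u]
        = frechet_derivative (h u) (at x) w - frechet_derivative (h w) (at x) u"
    if c: "c \<in> \<A>" "f x \<in> fst c" for c u w
  proof -
    define S' where "S' = S \<inter> f -` (fst c \<inter> V)"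
    have S': "open S'" unfolding S'_def
      by (intro smooth_into_open_vimage[OF f] open_Int open_chart c V)
    have xS': "x \<in> S'" using x c by (simp add: S'_def)
    define T where "T = snd c ` (fst c \<inter> V)"
    define \<phi> where "\<phi> = snd c \<circ> f"
    have \<phi>: "smooth_on S' \<phi>" unfolding \<phi>_def
      by (rule smooth_on_subset[OF smooth_into_coord[OF f c(1)] S']) (auto simp: S'_def)
    have sub: "\<phi> ` S' \<subseteq> T" by (auto simp: S'_def \<phi>_def T_def)
    define \<theta> where "\<theta> = coord_form \<A> c \<omega>"
    have \<theta>: "smooth_on T (\<lambda>y. \<theta> y u)" for u
      using coord_form_smooth[OF \<omega> c(1)] by (simp add: \<theta>_def T_def)
    have lin: "linear (\<theta> y)" if "y \<in> T" for y
      using coord_form_linear[OF \<omega> c(1)] that by (simp add: \<theta>_def T_def)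
    define k where "k u x = \<theta> (\<phi> x) (frechet_derivative \<phi> (at x) u)" for u x
    have hk: "h u x = k u x" if "x \<in> S'" for u x
      using one_form_push[OF f, of x c \<omega> u] c that
      by (simp add: h_def k_def \<theta>_def \<phi>_def S'_def)
    have der: "(k u has_derivative (\<lambda>w.
        \<theta> (\<phi> y) (frechet_derivative (\<lambda>x. frechet_derivative \<phi> (at x) u) (at y) w) +
        frechet_derivative (\<lambda>z. \<theta> z (frechet_derivative \<phi> (at y) u)) (at (\<phi> y)) (frechet_derivative \<phi> (at y) w)))
        (at y)" if "y \<in> S'" for y u
      unfolding k_def by (rule pullback_one_form(1)[OF \<phi> sub \<theta> lin that])
    have Dk: "(h u has_derivative frechet_derivative (k u) (at y)) (at y)" if "y \<in> S'" for y u
      by (rule has_derivative_transform_within_open[OF _ S' that hk[symmetric]])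
         (use der[OF that, of u] in \<open>auto simp: frechet_derivative_works[symmetric] differentiable_def\<close>)
    have hk': "frechet_derivative (h u) (at y) = frechet_derivative (k u) (at y)" if "y \<in> S'" for y u
      by (rule frechet_derivative_at[OF Dk[OF that], symmetric])
    have Dk': "frechet_derivative (k u) (at y) w =
        \<theta> (\<phi> y) (frechet_derivative (\<lambda>x. frechet_derivative \<phi> (at x) u) (at y) w) +
        frechet_derivative (\<lambda>z. \<theta> z (frechet_derivative \<phi> (at y) u)) (at (\<phi> y)) (frechet_derivative \<phi> (at y) w)"
      if "y \<in> S'" for y u w
      using fun_cong[OF frechet_derivative_at[OF der[OF that, of u]], of w] by simp
    have "continuous_on S' (\<lambda>x. frechet_derivative (h u) (at x) w)"
      by (rule continuous_on_eq[OF pullback_one_form(2)[OF \<phi> sub \<theta> lin]])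
         (simp_all add: hk' Dk')
    moreover have "ext_d_in \<A> c \<omega> (f x) [push \<A> f x w, push \<A> f x u]
        = frechet_derivative (k u) (at x) w - frechet_derivative (k w) (at x) u"
      using pullback_one_form_antisym[OF \<phi> sub \<theta> lin xS', of u w] c
      by (simp add: ext_d_in_one_form push_def k_def[abs_def] \<phi>_def \<theta>_def)
    ultimately show ?thesis
      using Dk[OF xS'] S' xS' by (simp add: hk'[OF xS'] continuous_on_eq_continuous_at)
  qed
  \<comment> \<open>The first two conclusions mention no chart, so any chart at \<open>f x\<close>
    supplies them.\<close>
  obtain d where "d \<in> \<A>" "f x \<in> fst d" by (rule chart_at)
  with * show "(h u has_derivative frechet_derivative (h u) (at x)) (at x)"
    "isCont (\<lambda>x. frechet_derivative (h u) (at x) w) x" by blast+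
  show "c \<in> \<A> \<Longrightarrow> f x \<in> fst c \<Longrightarrow> ext_d_in \<A> c \<omega> (f x) [push \<A> f x w, push \<A> f x u]
       = frechet_derivative (h u) (at x) w - frechet_derivative (h w) (at x) u"
    using * by blast
qed

text \<open>The inverse of one chart is itself a smooth map, so computing \<open>d\<omega>\<close> on its pushforwards in
  another chart compares the two charts.\<close>

lemma ext_d_one_form:
  assumes \<omega>: "is_form \<A> 1 V \<omega>" and V: "open V" and p: "p \<in> V"
    and v: "v \<in> tangent_space \<A> p" and w: "w \<in> tangent_space \<A> p" and c: "c \<in> \<A>" "p \<in> fst c"
  shows "ext_d \<A> \<omega> p [v, w] = ext_d_in \<A> c \<omega> p [v, w]"
proof -
  have "ext_d_in \<A> d \<omega> p [v, w] = ext_d_in \<A> c \<omega> p [v, w]" if d: "d \<in> \<A>" "p \<in> fst d" for d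
  proof -
    note f = chart_inv_smooth_into[OF c(1)]
    have x: "snd c p \<in> snd c ` fst c" "chart_inv c (snd c p) = p" using c chart_inv_left[OF c(1)] by auto
    have push: "push \<A> (chart_inv c) (snd c p) (v c) = v" if "v \<in> tangent_space \<A> p" for v
      using coord_vec_tangent_vector[OF that c] by (simp add: coord_vec_def)
    show ?thesis
      using one_form_pullback(3)[OF \<omega> V f x(1), of d "v c" "w c"]
        one_form_pullback(3)[OF \<omega> V f x(1), of c "v c" "w c"] p c d v w
      by (simp add: x(2) push)
  qed
  then show ?thesis
    unfolding ext_d_def using c by (intro the_equality; metis)
qed

section \<open>Functions and their logarithmic derivatives\<close>

lemma smooth_fun_has_derivative:
  assumes h: "smooth_fun \<A> V h" and f: "smooth_into \<A> S f" "x \<in> S" "f x \<in> V" and c: "c \<in> \<A>" "f x \<in> fst c"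
  shows "(h \<circ> f has_derivative
    (\<lambda>u. frechet_derivative (h \<circ> chart_inv c) (at (snd c (f x))) (push \<A> f x u c))) (at x)"
proof -
  have h': "smooth_on (snd c ` (fst c \<inter> V)) (h \<circ> chart_inv c)"
    using h c by (simp add: smooth_fun_def)
  have "((h \<circ> chart_inv c) \<circ> (snd c \<circ> f) has_derivative
      frechet_derivative (h \<circ> chart_inv c) (at (snd c (f x))) \<circ> (\<lambda>u. push \<A> f x u c)) (at x)"
    by (rule diff_chain_at[OF smooth_into_coord_has_derivative[OF f(1,2) c]])
       (use smooth_on_has_derivative[OF h', of "snd c (f x)"] c f in simp)
  then have "(h \<circ> f has_derivative
      frechet_derivative (h \<circ> chart_inv c) (at (snd c (f x))) \<circ> (\<lambda>u. push \<A> f x u c)) (at x)"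
    by (rule has_derivative_transform_within_open[OF _ smooth_into_open_vimage[OF f(1) open_chart[OF c(1)]]])
       (use f c chart_inv_left[OF c(1)] in auto)
  then show ?thesis by (simp add: comp_def)
qed

text \<open>The description in \<open>ext_d\<close> needs all charts to give one value; the chain
  rule through the inverse of \<open>c\<close> compares any chart \<open>d\<close> with
  \<open>c\<close>.\<close>

lemma dlog_form_coord:
  assumes h: "smooth_fun \<A> V h" and p: "p \<in> V" and v: "v \<in> tangent_space \<A> p" and c: "c \<in> \<A>" "p \<in> fst c"
  shows "dlog_form \<A> h p [v] = frechet_derivative (h \<circ> chart_inv c) (at (snd c p)) (v c) / h p"
proof -
  have ext: "ext_d_in \<A> d (\<lambda>q _. h q) p [v] = frechet_derivative (h \<circ> chart_inv d) (at (snd d p)) (v d)" for d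
    by (simp add: ext_d_in_def comp_def)
  have "frechet_derivative (h \<circ> chart_inv d) (at (snd d p)) (v d)
      = frechet_derivative (h \<circ> chart_inv c) (at (snd c p)) (v c)" if d: "d \<in> \<A>" "p \<in> fst d" for d
  proof -
    have x: "snd c p \<in> snd c ` fst c" "chart_inv c (snd c p) = p" using c chart_inv_left[OF c(1)] by auto
    have push: "push \<A> (chart_inv c) (snd c p) (v c) = v"
      using coord_vec_tangent_vector[OF v c] by (simp add: coord_vec_def)
    have "(h \<circ> chart_inv c has_derivative (\<lambda>u. frechet_derivative (h \<circ> chart_inv d) (at (snd d p))
        (push \<A> (chart_inv c) (snd c p) u d))) (at (snd c p))"
      using smooth_fun_has_derivative[OF h chart_inv_smooth_into[OF c(1)] x(1), of d] p d
      by (simp add: x(2))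
    from fun_cong[OF frechet_derivative_at[OF this], of "v c"] show ?thesis by (simp add: push)
  qed
  then have "ext_d \<A> (\<lambda>q _. h q) p [v] = frechet_derivative (h \<circ> chart_inv c) (at (snd c p)) (v c)"
    unfolding ext_d_def ext using c by (intro the_equality; metis)
  then show ?thesis by (simp add: dlog_form_def)
qed

lemma dlog_form_push:
  assumes h: "smooth_fun \<A> V h" "h (f x) \<noteq> 0" and f: "smooth_into \<A> S f" "x \<in> S" "f x \<in> V"
  shows "(h \<circ> f has_derivative (\<lambda>u. dlog_form \<A> h (f x) [push \<A> f x u] * h (f x))) (at x)"
proof -
  obtain c where c: "c \<in> \<A>" "f x \<in> fst c" by (rule chart_at)
  show ?thesis
    using smooth_fun_has_derivative[OF h(1) f c] h(2) c f
    by (simp add: dlog_form_coord[OF h(1) f(3) push_tangent[OF f(1,2)] c])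
qed

text \<open>\<open>dlog\<close> is closed: with F the function in a chart, the derivative of F_u / F
  in direction w is (F_uw F - F_u F_w) / F^2, which is symmetric in u and w.\<close>

lemma ext_d_add_dlog:
  assumes a: "is_form \<A> 1 V a" and b: "is_form \<A> 1 V b" and V: "open V"
    and h: "smooth_fun \<A> V h" "\<And>q. q \<in> V \<Longrightarrow> h q \<noteq> 0"
    and eq: "form_eq \<A> 1 V b (\<lambda>p vs. a p vs + dlog_form \<A> h p vs)"
    and p: "p \<in> V" and v: "v \<in> tangent_space \<A> p" and w: "w \<in> tangent_space \<A> p"
  shows "ext_d \<A> b p [v, w] = ext_d \<A> a p [v, w]"
proof -
  obtain c where c: "c \<in> \<A>" "p \<in> fst c" by (rule chart_at)
  define T where "T = snd c ` (fst c \<inter> V)"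
  define F where "F = h \<circ> chart_inv c"
  have F: "smooth_on T F" using h c by (simp add: smooth_fun_def F_def T_def)
  have y: "snd c p \<in> T" using c p by (simp add: T_def)
  have F0: "F y \<noteq> 0" if "y \<in> T" for y
    using that h(2) by (auto simp: F_def T_def chart_inv_left[OF c(1)])
  have coord: "coord_form \<A> c b y u = coord_form \<A> c a y u + frechet_derivative F (at y) u / F y"
    if "y \<in> T" for y u
  proof -
    obtain q where q: "q \<in> fst c" "q \<in> V" "y = snd c q" "chart_inv c y = q"
      using \<open>y \<in> T\<close> chart_inv_left[OF c(1)] by (auto simp: T_def)
    note t = coord_vec_tangent[OF c(1) q(1), of u]
    \<comment> \<open>The change from \<open>c\<close> to itself is the identity near
      \<open>snd c q\<close>, so its Jacobian is the identity.\<close>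
    have "coord_vec \<A> c q u c = u"
    proof -
      have "(snd c \<circ> chart_inv c has_derivative (\<lambda>x. x)) (at (snd c q))"
        by (rule has_derivative_transform_within_open[OF has_derivative_ident smooth_on_open[OF F]])
           (use q \<open>y \<in> T\<close> in \<open>auto simp: T_def chart_inv_left[OF c(1)]\<close>)
      from fun_cong[OF frechet_derivative_at[OF this], of u] show ?thesis
        using q c by (simp add: coord_vec_def push_def chart_inv_left)
    qed
    then show ?thesis
      using eq q(2) t dlog_form_coord[OF h(1) q(2) t c(1) q(1)] q c
      by (simp add: coord_form_def form_eq_def tangent_lists_def F_def chart_inv_left)
  qed
  have "frechet_derivative (\<lambda>y. coord_form \<A> c b y u) (at (snd c p)) w
      = frechet_derivative (\<lambda>y. coord_form \<A> c a y u) (at (snd c p)) w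
      + (frechet_derivative (\<lambda>y. frechet_derivative F (at y) u) (at (snd c p)) w * F (snd c p)
         - frechet_derivative F (at (snd c p)) u * frechet_derivative F (at (snd c p)) w)
        / (F (snd c p) * F (snd c p))" for u w
  proof -
    have "((\<lambda>y. coord_form \<A> c a y u + frechet_derivative F (at y) u / F y) has_derivative
      (\<lambda>w. frechet_derivative (\<lambda>y. coord_form \<A> c a y u) (at (snd c p)) w
        + (frechet_derivative (\<lambda>y. frechet_derivative F (at y) u) (at (snd c p)) w * F (snd c p)
         - frechet_derivative F (at (snd c p)) u * frechet_derivative F (at (snd c p)) w)
        / (F (snd c p) * F (snd c p)))) (at (snd c p))"
      by (intro has_derivative_add has_derivative_divide'
          smooth_on_has_derivative[OF smooth_on_derivative[OF F] y] smooth_on_has_derivative[OF F y]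
          smooth_on_has_derivative[OF coord_form_smooth[OF a c(1)] y[unfolded T_def]] F0[OF y])
    then have "((\<lambda>y. coord_form \<A> c b y u) has_derivative
      (\<lambda>w. frechet_derivative (\<lambda>y. coord_form \<A> c a y u) (at (snd c p)) w
        + (frechet_derivative (\<lambda>y. frechet_derivative F (at y) u) (at (snd c p)) w * F (snd c p)
         - frechet_derivative F (at (snd c p)) u * frechet_derivative F (at (snd c p)) w)
        / (F (snd c p) * F (snd c p)))) (at (snd c p))"
      by (rule has_derivative_transform_within_open[OF _ smooth_on_open[OF F] y]) (simp add: coord)
    from fun_cong[OF frechet_derivative_at[OF this], of w] show ?thesis by simp
  qed
  then have "ext_d_in \<A> c b p [v, w] = ext_d_in \<A> c a p [v, w]"
    unfolding ext_d_in_one_form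
    by (simp add: symmetric_second_derivative[OF F y, of "v c" "w c"] mult.commute)
  then show ?thesis
    by (simp only: ext_d_one_form[OF a V p v w c] ext_d_one_form[OF b V p v w c])
qed

section \<open>Affine reparametrization, restriction and coordinate slices\<close>

lemma smooth_into_affine:
  assumes f: "smooth_into \<A> S f" and l: "bounded_linear l"
  shows "smooth_into \<A> ((\<lambda>x. q + l x) -` S) (\<lambda>x. f (q + l x))"
proof -
  have cont: "continuous_on UNIV (\<lambda>x. q + l x)"
    by (intro continuous_intros bounded_linear.continuous_on[OF l])
  show "smooth_into \<A> ((\<lambda>x. q + l x) -` S) (\<lambda>x. f (q + l x))"
    unfolding smooth_into_def
  proof (intro conjI ballI)
    show "open ((\<lambda>x. q + l x) -` S)"
      using f open_vimage cont by (auto simp: smooth_into_def)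
    show "continuous_on ((\<lambda>x. q + l x) -` S) (\<lambda>x. f (q + l x))"
      by (rule continuous_on_compose2[OF smooth_into_continuous[OF f]])
         (auto intro: continuous_on_subset[OF cont])
    fix c assume "c \<in> \<A>"
    from smooth_on_affine[OF smooth_into_coord[OF f this] l, of q]
    show "smooth_on ((\<lambda>x. q + l x) -` S \<inter> (\<lambda>x. f (q + l x)) -` fst c) (snd c \<circ> (\<lambda>x. f (q + l x)))"
      by (simp add: comp_def vimage_def Int_def)
  qed
qed

lemma push_affine:
  assumes f: "smooth_into \<A> S f" and l: "bounded_linear l" and x: "q + l x \<in> S"
  shows "push \<A> (\<lambda>x. f (q + l x)) x u = push \<A> f (q + l x) (l u)"
proof
  fix c
  show "push \<A> (\<lambda>x. f (q + l x)) x u c = push \<A> f (q + l x) (l u) c"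
  proof (cases "c \<in> \<A> \<and> f (q + l x) \<in> fst c")
    case True
    have "((\<lambda>x. q + l x) has_derivative l) (at x)"
      using bounded_linear_imp_has_derivative[OF l] by (auto intro!: derivative_eq_intros)
    from diff_chain_at[OF this smooth_into_coord_has_derivative[OF f x, of c]] True
    have "(snd c \<circ> (\<lambda>x. f (q + l x)) has_derivative (\<lambda>u. push \<A> f (q + l x) (l u) c)) (at x)"
      by (simp add: comp_def)
    from fun_cong[OF frechet_derivative_at[OF this], of u]
    have "push \<A> f (q + l x) (l u) c = frechet_derivative (snd c \<circ> (\<lambda>x. f (q + l x))) (at x) u" .
    also have "\<dots> = push \<A> (\<lambda>x. f (q + l x)) x u c"
      unfolding push_def using True by (simp only: if_True simp_thms)
    finally show ?thesis by (rule sym)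
  next
    case False
    then show ?thesis by (auto simp: push_def)
  qed
qed

lemma is_form_subset:
  assumes \<omega>: "is_form \<A> k V \<omega>" and W: "open W" "W \<subseteq> V"
  shows "is_form \<A> k W \<omega>"
proof -
  have "open (snd c ` (fst c \<inter> W))" if c: "c \<in> \<A>" for c
  proof -
    have "snd c ` fst c \<inter> chart_inv c -` W = snd c ` (fst c \<inter> W)"
      using chart_inv_left[OF c] by auto
    then show ?thesis
      using smooth_into_open_vimage[OF chart_inv_smooth_into[OF c] W(1)] by simp
  qed
  then have smooth: "smooth_on (snd c ` (fst c \<inter> W)) h"
    if "c \<in> \<A>" "smooth_on (snd c ` (fst c \<inter> V)) h" for c and h :: "'e \<Rightarrow> complex"
    by (rule smooth_on_subset[OF that(2)]) (use W(2) that(1) in auto)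
  have ball: "\<forall>p\<in>W. P p" if "\<forall>p\<in>V. P p" for P
    using that W(2) by blast
  note \<omega>' = \<omega>[unfolded is_form_def]
  show ?thesis
    unfolding is_form_def
    by (rule conjI, rule ball[OF conjunct1[OF \<omega>']]) (use smooth conjunct2[OF \<omega>'] in simp)
qed

text \<open>The velocities in \<open>rotation_field\<close>, \<open>loop_velocity\<close> and
  parallel lifts are those of one-variable slices; here they become pushforwards of (1, 0) and (0,
  1) under one map of two variables.\<close>

lemma
  fixes f :: "real \<times> real \<Rightarrow> 'm"
  assumes f: "smooth_into \<A> UNIV f"
  shows slice1_smooth: "smooth_into \<A> UNIV (\<lambda>t. f (t, s))"
    and slice2_smooth: "smooth_into \<A> UNIV (\<lambda>s. f (t, s))"
    and push_slice1: "push \<A> (\<lambda>t. f (t, s)) t 1 = push \<A> f (t, s) (1, 0)"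
    and push_slice2: "push \<A> (\<lambda>s. f (t, s)) s 1 = push \<A> f (t, s) (0, 1)"
proof -
  have l: "bounded_linear (\<lambda>t::real. (t, 0::real))" "bounded_linear (\<lambda>s::real. (0::real, s))"
    by (intro bounded_linear_Pair bounded_linear_ident bounded_linear_zero)+
  show "smooth_into \<A> UNIV (\<lambda>t. f (t, s))" "smooth_into \<A> UNIV (\<lambda>s. f (t, s))"
    using smooth_into_affine[OF f l(1), of "(0, s)"] smooth_into_affine[OF f l(2), of "(t, 0)"]
    by simp_all
  show "push \<A> (\<lambda>t. f (t, s)) t 1 = push \<A> f (t, s) (1, 0)"
    "push \<A> (\<lambda>s. f (t, s)) s 1 = push \<A> f (t, s) (0, 1)"
    using push_affine[OF f l(1), of "(0, s)" t 1] push_affine[OF f l(2), of "(t, 0)" s 1]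
    by simp_all
qed

end


section \<open>Parallel transport and its first variation\<close>

text \<open>\<open>parallel_lift\<close> on an arbitrary interval, so that transport can be cut into
  pieces that each lie in one frame.\<close>

definition lift_on ::
    "('m::topological_space, 'e::euclidean_space) chart set \<Rightarrow> ('m, 'e, 'l) line_bundle
      \<Rightarrow> 'm loop \<Rightarrow> real \<Rightarrow> real \<Rightarrow> (real \<Rightarrow> 'l) \<Rightarrow> bool" where
  "lift_on \<A> L \<gamma> u v l \<longleftrightarrow>
     (\<forall>t\<in>{u..v}. proj L (l t) = \<gamma> t) \<and>
     (\<forall>(V, e)\<in>frames L. \<forall>t\<in>{u..v}. \<gamma> t \<in> V \<longrightarrow>
        ((\<lambda>r. frame_coeff L e (l r)) has_vector_derivative
           - potential L (V, e) (\<gamma> t) [push \<A> \<gamma> t 1] * frame_coeff L e (l t))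
          (at t within {u..v}))"

lemma parallel_lift_eq_lift_on: "parallel_lift \<A> L \<gamma> l = lift_on \<A> L \<gamma> 0 1 l"
  by (simp add: parallel_lift_def lift_on_def)

lemma lift_on_proj: "lift_on \<A> L \<gamma> u v l \<Longrightarrow> t \<in> {u..v} \<Longrightarrow> proj L (l t) = \<gamma> t"
  by (simp add: lift_on_def)

lemma lift_on_has_vector_derivative:
  assumes "lift_on \<A> L \<gamma> u v l" "(V, e) \<in> frames L" "t \<in> {u..v}" "\<gamma> t \<in> V"
  shows "((\<lambda>r. frame_coeff L e (l r)) has_vector_derivative
           - potential L (V, e) (\<gamma> t) [push \<A> \<gamma> t 1] * frame_coeff L e (l t)) (at t within {u..v})"
  using assms unfolding lift_on_def by fast

lemma lift_on_subinterval:
  assumes "lift_on \<A> L \<gamma> u v l" "{u'..v'} \<subseteq> {u..v}"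
  shows "lift_on \<A> L \<gamma> u' v' l"
  unfolding lift_on_def
proof (intro conjI ballI, goal_cases)
  case (1 t)
  then show ?case using assms lift_on_proj by blast
next
  case (2 Ve)
  obtain V e where Ve: "Ve = (V, e)" by fastforce
  show ?case
    unfolding Ve prod.case
  proof (intro ballI impI)
    fix t assume "t \<in> {u'..v'}" "\<gamma> t \<in> V"
    then show "((\<lambda>r. frame_coeff L e (l r)) has_vector_derivative
           - potential L (V, e) (\<gamma> t) [push \<A> \<gamma> t 1] * frame_coeff L e (l t)) (at t within {u'..v'})"
      using has_vector_derivative_within_subset[OF lift_on_has_vector_derivative[OF assms(1)] assms(2)]
        2 Ve assms(2) by blast
  qed
qed

text \<open>At \<open>v\<close> the two one-sided derivatives agree because the lifts do. At a point
  outside one of the closed pieces the filter within that piece is \<open>bot\<close>, so that piece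
  imposes nothing.\<close>

lemma lift_on_join:
  assumes l: "lift_on \<A> L \<gamma> u v l" and l': "lift_on \<A> L \<gamma> v w l'" and eq: "l v = l' v"
    and uv: "u \<le> v" "v \<le> w"
  defines "j \<equiv> \<lambda>r. if r \<le> v then l r else l' r"
  shows "lift_on \<A> L \<gamma> u w j"
  unfolding lift_on_def
proof (intro conjI ballI, goal_cases)
  case (1 t)
  then show ?case using lift_on_proj[OF l] lift_on_proj[OF l'] by (auto simp: j_def)
next
  case (2 Ve)
  obtain V e where Ve: "Ve = (V, e)" by fastforce
  have fr: "(V, e) \<in> frames L" using 2 Ve by simp
  have j: "j r = l r" if "r \<in> {u..v}" for r using that by (simp add: j_def)
  have j': "j r = l' r" if "r \<in> {v..w}" for r using that eq by (auto simp: j_def)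
  show ?case
    unfolding Ve prod.case
  proof (intro ballI impI)
    fix t assume t: "t \<in> {u..w}" "\<gamma> t \<in> V"
    let ?D = "- potential L (V, e) (\<gamma> t) [push \<A> \<gamma> t 1] * frame_coeff L e (j t)"
    have "((\<lambda>r. frame_coeff L e (j r)) has_vector_derivative ?D) (at t within {u..v})"
    proof (cases "t \<in> {u..v}")
      case True
      have "((\<lambda>r. frame_coeff L e (l r)) has_vector_derivative ?D) (at t within {u..v})"
        using lift_on_has_vector_derivative[OF l fr True t(2)] j[OF True] by simp
      then show ?thesis
        by (rule has_vector_derivative_transform[OF True, rotated]) (simp add: j)
    next
      case False
      then have "at t within {u..v} = bot" by (simp add: at_within_eq_bot_iff)
      then show ?thesis by (simp only: has_vector_derivative_bot)
    qed
    moreover have "((\<lambda>r. frame_coeff L e (j r)) has_vector_derivative ?D) (at t within {v..w})"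
    proof (cases "t \<in> {v..w}")
      case True
      have "((\<lambda>r. frame_coeff L e (l' r)) has_vector_derivative ?D) (at t within {v..w})"
        using lift_on_has_vector_derivative[OF l' fr True t(2)] j'[OF True] by simp
      then show ?thesis
        by (rule has_vector_derivative_transform[OF True, rotated]) (simp add: j')
    next
      case False
      then have "at t within {v..w} = bot" by (simp add: at_within_eq_bot_iff)
      then show ?thesis by (simp only: has_vector_derivative_bot)
    qed
    ultimately show "((\<lambda>r. frame_coeff L e (j r)) has_vector_derivative ?D) (at t within {u..w})"
      using has_vector_derivative_within_Un ivl_disj_un_two_touch(4)[OF uv] by metis
  qed
qed

text \<open>F is the ratio of the coordinates of a parallel lift at the two ends, the start over the end;
  this is the direction in which the holonomy is measured.\<close>

definition transport ::
    "('m::topological_space, 'e::euclidean_space) chart set \<Rightarrow> ('m, 'e, 'l) line_bundle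
      \<Rightarrow> 'm loop \<Rightarrow> real \<Rightarrow> real \<Rightarrow> ('m \<Rightarrow> 'l) \<Rightarrow> ('m \<Rightarrow> 'l) \<Rightarrow> complex \<Rightarrow> bool" where
  "transport \<A> L \<gamma> u v e e' F \<longleftrightarrow>
     (\<forall>l. lift_on \<A> L \<gamma> u v l \<longrightarrow> frame_coeff L e (l u) = F * frame_coeff L e' (l v)) \<and>
     (\<forall>y. proj L y = \<gamma> v \<longrightarrow> (\<exists>l. lift_on \<A> L \<gamma> u v l \<and> l v = y))"

text \<open>Existence runs backwards: a lift on the later interval ending at \<open>y\<close> is
  chosen first, then one on the earlier interval ending where that lift starts.\<close>

lemma transport_trans:
  assumes T: "transport \<A> L \<gamma> u v e e' F" and T': "transport \<A> L \<gamma> v w e' e'' F'"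
    and uv: "u \<le> v" "v \<le> w"
  shows "transport \<A> L \<gamma> u w e e'' (F * F')"
  unfolding transport_def
proof (intro conjI allI impI)
  fix l assume l: "lift_on \<A> L \<gamma> u w l"
  have "lift_on \<A> L \<gamma> u v l" "lift_on \<A> L \<gamma> v w l"
    using uv by (auto intro: lift_on_subinterval[OF l])
  then show "frame_coeff L e (l u) = F * F' * frame_coeff L e'' (l w)"
    using T T' by (simp add: transport_def mult.assoc)
next
  fix y assume "proj L y = \<gamma> w"
  then obtain l' where l': "lift_on \<A> L \<gamma> v w l'" "l' w = y"
    using T' unfolding transport_def by blast
  then have "proj L (l' v) = \<gamma> v" using lift_on_proj uv by fastforce
  then obtain l where l: "lift_on \<A> L \<gamma> u v l" "l v = l' v"
    using T unfolding transport_def by blast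
  \<comment> \<open>The joined lift takes its value at \<open>w\<close> from \<open>l\<close> only
    in the degenerate case \<open>w = v\<close>, where the two lifts agree.\<close>
  have "(if w \<le> v then l w else l' w) = y" using uv l l' by (cases "w = v") auto
  then show "\<exists>l. lift_on \<A> L \<gamma> u w l \<and> l w = y"
    using lift_on_join[OF l(1) l'(1) l(2) uv] by (intro exI conjI)
qed

context
  fixes \<A> :: "('m::{t2_space,second_countable_topology}, 'e::euclidean_space) chart set"
    and L :: "('m, 'e, 'l) line_bundle"
  assumes atlas: "smooth_atlas \<A>"
    and herm: "hermitian_line_bundle \<A> L"
    and conn: "unitary_connection \<A> L"
begin

section \<open>Frames, coefficients and transition functions\<close>

lemma frame_at: obtains V e where "(V, e) \<in> frames L" "p \<in> V"
proof -
  have "(\<Union>(V, e)\<in>frames L. V) = UNIV" using herm unfolding hermitian_line_bundle_def by (elim conjE)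
  then show thesis using that by blast
qed

lemma scale_scale: "scale L z (scale L w x) = scale L (z * w) x"
  using herm unfolding hermitian_line_bundle_def by (elim conjE) (elim allE)

lemma proj_scale: "proj L (scale L z x) = proj L x"
  using herm unfolding hermitian_line_bundle_def by (elim conjE) (elim allE)

lemma frame_unfold:
  assumes "(V, e) \<in> frames L"
  shows "open V \<and> (\<forall>p\<in>V. proj L (e p) = p \<and> len L (e p) = 1 \<and>
        (\<forall>x. proj L x = p \<longrightarrow> (\<exists>!z. x = scale L z (e p))))"
proof -
  have "\<forall>(V, e)\<in>frames L. open V \<and> (\<forall>p\<in>V. proj L (e p) = p \<and> len L (e p) = 1 \<and>
        (\<forall>x. proj L x = p \<longrightarrow> (\<exists>!z. x = scale L z (e p))))"
    using herm unfolding hermitian_line_bundle_def by (elim conjE)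
  from bspec[OF this assms] show ?thesis unfolding prod.case .
qed

lemma open_frame: "(V, e) \<in> frames L \<Longrightarrow> open V"
  using frame_unfold by blast

lemma frame_proj: "(V, e) \<in> frames L \<Longrightarrow> p \<in> V \<Longrightarrow> proj L (e p) = p"
  using frame_unfold by blast

lemma scale_frame_coeff:
  assumes "(V, e) \<in> frames L" "proj L x \<in> V"
  shows "scale L (frame_coeff L e x) (e (proj L x)) = x"
proof -
  have "\<exists>!z. x = scale L z (e (proj L x))" using frame_unfold[OF assms(1)] assms(2) by blast
  from theI'[OF this] show ?thesis by (simp add: frame_coeff_def)
qed

lemma frame_coeff_scale_frame:
  assumes e: "(V, e) \<in> frames L" and p: "p \<in> V"
  shows "frame_coeff L e (scale L z (e p)) = z"
proof -
  have *: "proj L (scale L z (e p)) = p" using frame_proj[OF e p] by (simp add: proj_scale)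
  have "\<exists>!w. scale L z (e p) = scale L w (e p)" using frame_unfold[OF e] p * by blast
  moreover have "scale L z (e p) = scale L (frame_coeff L e (scale L z (e p))) (e p)"
    using scale_frame_coeff[OF e, of "scale L z (e p)"] p by (simp add: *)
  ultimately show ?thesis by metis
qed

lemma frame_coeff_scale:
  assumes e: "(V, e) \<in> frames L" and x: "proj L x \<in> V"
  shows "frame_coeff L e (scale L z x) = z * frame_coeff L e x"
proof -
  have "scale L z x = scale L (z * frame_coeff L e x) (e (proj L x))"
    using scale_frame_coeff[OF e x] scale_scale by metis
  then show ?thesis using frame_coeff_scale_frame[OF e x] by simp
qed

lemma frame_coeff_change:
  assumes e: "(V, e) \<in> frames L" and e': "(V', e') \<in> frames L" and x: "proj L x \<in> V" "proj L x \<in> V'"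
  shows "frame_coeff L e x = frame_coeff L e (e' (proj L x)) * frame_coeff L e' x"
proof -
  have "frame_coeff L e x = frame_coeff L e (scale L (frame_coeff L e' x) (e' (proj L x)))"
    by (simp add: scale_frame_coeff[OF e' x(2)])
  also have "\<dots> = frame_coeff L e' x * frame_coeff L e (e' (proj L x))"
    by (rule frame_coeff_scale[OF e]) (simp add: frame_proj[OF e' x(2)] x)
  finally show ?thesis by simp
qed

text \<open>A zero coefficient would give \<open>e' p\<close> length 0, while frames have unit
  length.\<close>

lemma transition_nonzero:
  assumes e: "(V, e) \<in> frames L" and e': "(V', e') \<in> frames L" and p: "p \<in> V" "p \<in> V'"
  shows "frame_coeff L e (e' p) \<noteq> 0"
proof
  assume "frame_coeff L e (e' p) = 0"
  then have "e' p = scale L 0 (e p)"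
    using scale_frame_coeff[OF e, of "e' p"] p by (simp add: frame_proj[OF e' p(2)])
  moreover have "len L (scale L 0 (e p)) = cmod 0 * len L (e p)"
    using herm unfolding hermitian_line_bundle_def by (elim conjE) (elim allE)
  moreover have "len L (e' p) = 1" using frame_unfold[OF e'] p by blast
  ultimately show False by simp
qed

lemma transition_smooth_fun:
  assumes e: "(V, e) \<in> frames L" and e': "(V', e') \<in> frames L"
  shows "smooth_fun \<A> (V \<inter> V') (\<lambda>p. frame_coeff L e (e' p))"
proof -
  have "\<forall>(V, e)\<in>frames L. \<forall>(V', e')\<in>frames L. smooth_fun \<A> (V \<inter> V') (\<lambda>p. frame_coeff L e (e' p))"
    using herm unfolding hermitian_line_bundle_def by (elim conjE)
  with e e' show ?thesis by fast
qed

lemma potential_form: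
  assumes "(V, e) \<in> frames L"
  shows "is_form \<A> 1 V (potential L (V, e))"
proof -
  have "\<forall>(V, e)\<in>frames L. is_form \<A> 1 V (potential L (V, e)) \<and> imaginary_form \<A> 1 V (potential L (V, e))"
    using conn unfolding unitary_connection_def by (elim conjE)
  with assms show ?thesis by fast
qed

lemma potential_change:
  assumes e: "(V, e) \<in> frames L" and e': "(V', e') \<in> frames L"
  shows "form_eq \<A> 1 (V \<inter> V') (potential L (V', e'))
          (\<lambda>p vs. potential L (V, e) p vs + dlog_form \<A> (\<lambda>q. frame_coeff L e (e' q)) p vs)"
proof -
  have "\<forall>(V, e)\<in>frames L. \<forall>(V', e')\<in>frames L. form_eq \<A> 1 (V \<inter> V') (potential L (V', e'))
          (\<lambda>p vs. potential L (V, e) p vs + dlog_form \<A> (\<lambda>q. frame_coeff L e (e' q)) p vs)"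
    using conn unfolding unitary_connection_def by (elim conjE)
  with e e' show ?thesis by fast
qed

text \<open>The law b = a + dlog g for the two potentials, read along \<open>f\<close> as the
  differential equation dg = (b - a) g.\<close>

lemma transition_has_derivative_along:
  assumes e: "(V, e) \<in> frames L" and e': "(V', e') \<in> frames L"
    and f: "smooth_into \<A> S f" "x \<in> S" and fx: "f x \<in> V" "f x \<in> V'"
  shows "((\<lambda>x. frame_coeff L e (e' (f x))) has_derivative
     (\<lambda>u. (potential L (V', e') (f x) [push \<A> f x u] - potential L (V, e) (f x) [push \<A> f x u])
        * frame_coeff L e (e' (f x)))) (at x)"
proof -
  have "dlog_form \<A> (\<lambda>q. frame_coeff L e (e' q)) (f x) [push \<A> f x u]
      = potential L (V', e') (f x) [push \<A> f x u] - potential L (V, e) (f x) [push \<A> f x u]" for u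
    using potential_change[OF e e'] fx push_tangent[OF atlas f, of u]
    by (simp add: form_eq_def tangent_lists_def)
  then show ?thesis
    using dlog_form_push[OF atlas transition_smooth_fun[OF e e'] transition_nonzero[OF e e' fx] f] fx
    by (simp add: comp_def)
qed

text \<open>A change of frame alters the potential by a closed form, so the description in
  \<open>curvature\<close> has one value.\<close>

lemma curvature_eq:
  assumes e: "(V, e) \<in> frames L" and p: "p \<in> V"
    and v: "v \<in> tangent_space \<A> p" and w: "w \<in> tangent_space \<A> p"
  shows "curvature \<A> L p [v, w] = ext_d \<A> (potential L (V, e)) p [v, w]"
proof -
  have indep: "ext_d \<A> (potential L (V', e')) p [v, w] = ext_d \<A> (potential L (V, e)) p [v, w]"
    if e': "(V', e') \<in> frames L" and p': "p \<in> V'" for V' e'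
  proof -
    have op: "open (V \<inter> V')" using open_frame[OF e] open_frame[OF e'] by blast
    show ?thesis
      by (rule ext_d_add_dlog[OF atlas is_form_subset[OF atlas potential_form[OF e] op]
            is_form_subset[OF atlas potential_form[OF e'] op] op transition_smooth_fun[OF e e'] _
            potential_change[OF e e'] _ v w])
         (use p p' transition_nonzero[OF e e'] in auto)
  qed
  show ?thesis unfolding curvature_def
  proof (rule the_equality)
    show "\<forall>(V', e')\<in>frames L. p \<in> V' \<longrightarrow>
        ext_d \<A> (potential L (V, e)) p [v, w] = ext_d \<A> (potential L (V', e')) p [v, w]"
      using indep by fastforce
    show "y = ext_d \<A> (potential L (V, e)) p [v, w]"
      if "\<forall>(V, e)\<in>frames L. p \<in> V \<longrightarrow> y = ext_d \<A> (potential L (V, e)) p [v, w]" for y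
      using that e p by fast
  qed
qed

section \<open>Transport inside one frame, change of frames, holonomy\<close>

lemma potential_along_continuous:
  assumes e: "(V, e) \<in> frames L" and f: "smooth_into \<A> S f" and x: "x \<in> S" "f x \<in> V"
  shows "isCont (\<lambda>x. potential L (V, e) (f x) [push \<A> f x u]) x"
  by (rule has_derivative_continuous
      [OF one_form_pullback(1)[OF atlas potential_form[OF e] open_frame[OF e] f x]])

text \<open>The factor \<open>c\<close> is 1 for the integrating factor that proves uniqueness of
  lifts, and -1 for the explicit solution that proves existence.\<close>

lemma integral_potential_has_vector_derivative:
  assumes e: "(V, e) \<in> frames L" and \<gamma>: "smooth_into \<A> UNIV \<gamma>" and sub: "\<gamma> ` {u..v} \<subseteq> V"
    and s: "s \<in> {u..v}"
  shows "((\<lambda>s. exp (c * integral {u..s} (\<lambda>r. potential L (V, e) (\<gamma> r) [push \<A> \<gamma> r 1])))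
    has_vector_derivative c * potential L (V, e) (\<gamma> s) [push \<A> \<gamma> s 1]
      * exp (c * integral {u..s} (\<lambda>r. potential L (V, e) (\<gamma> r) [push \<A> \<gamma> r 1]))) (at s within {u..v})"
proof -
  have "continuous_on {u..v} (\<lambda>r. potential L (V, e) (\<gamma> r) [push \<A> \<gamma> r 1])"
    by (intro continuous_at_imp_continuous_on ballI potential_along_continuous[OF e \<gamma>]) (use sub in auto)
  from integral_has_vector_derivative[OF this s]
  have "((\<lambda>s. c * integral {u..s} (\<lambda>r. potential L (V, e) (\<gamma> r) [push \<A> \<gamma> r 1])) has_vector_derivative
      c * potential L (V, e) (\<gamma> s) [push \<A> \<gamma> s 1]) (at s within {u..v})"
    by (rule has_vector_derivative_mult_right)
  from field_vector_diff_chain_within[OF this, of exp]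
  show ?thesis by (simp add: comp_def DERIV_exp has_field_derivative_at_within)
qed

text \<open>In the frame \<open>e\<close>, a parallel lift solves the scalar linear equation z' = -
  a z.\<close>

lemma transport_in_frame:
  assumes e: "(V, e) \<in> frames L" and \<gamma>: "smooth_into \<A> UNIV \<gamma>" and sub: "\<gamma> ` {u..v} \<subseteq> V"
    and uv: "u \<le> v"
  shows "transport \<A> L \<gamma> u v e e (exp (integral {u..v} (\<lambda>r. potential L (V, e) (\<gamma> r) [push \<A> \<gamma> r 1])))"
proof -
  define a where "a r = potential L (V, e) (\<gamma> r) [push \<A> \<gamma> r 1]" for r
  note exp_deriv = integral_potential_has_vector_derivative[OF e \<gamma> sub, folded a_def]
  have "frame_coeff L e (l u) = exp (integral {u..v} a) * frame_coeff L e (l v)"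
    if l: "lift_on \<A> L \<gamma> u v l" for l
  proof -
    \<comment> \<open>The coefficient times its integrating factor is constant; comparing its values
      at \<open>u\<close> and \<open>v\<close> gives the transport.\<close>
    define z where "z s = frame_coeff L e (l s) * exp (1 * integral {u..s} a)" for s
    have "(z has_derivative (\<lambda>h. 0)) (at s within {u..v})" if s: "s \<in> {u..v}" for s
    proof -
      have "\<gamma> s \<in> V" using sub s by blast
      from has_vector_derivative_mult[OF lift_on_has_vector_derivative[OF l e s this] exp_deriv[OF s, of 1]]
      have "(z has_vector_derivative 0) (at s within {u..v})"
        by (simp add: z_def[abs_def] a_def[abs_def] algebra_simps)
      then show ?thesis by (simp add: has_vector_derivative_def)
    qed
    then obtain k where "\<And>s. s \<in> {u..v} \<Longrightarrow> z s = k"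
      using has_derivative_zero_constant[of "{u..v}" z] by (metis convex_real_interval(5))
    then have "z u = z v" using uv by simp
    then show ?thesis by (simp add: z_def mult.commute)
  qed
  moreover have "\<exists>l. lift_on \<A> L \<gamma> u v l \<and> l v = y" if y: "proj L y = \<gamma> v" for y
  proof -
    \<comment> \<open>The solution normalized at the right end: the two integrals cancel at
      \<open>s = v\<close>, leaving the coefficient of \<open>y\<close>.\<close>
    define z where "z s = frame_coeff L e y * exp (1 * integral {u..v} a) * exp ((- 1) * integral {u..s} a)" for s
    define l where "l s = scale L (z s) (e (\<gamma> s))" for s
    have z: "(z has_vector_derivative - a s * z s) (at s within {u..v})" if "s \<in> {u..v}" for s
    proof -
      have "(z has_vector_derivative (frame_coeff L e y * exp (1 * integral {u..v} a)) *
          ((- 1) * a s * exp ((- 1) * integral {u..s} a))) (at s within {u..v})"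
        unfolding z_def[abs_def] by (rule has_vector_derivative_mult_right[OF exp_deriv[OF that]])
      then show ?thesis by (simp add: z_def algebra_simps)
    qed
    have "l v = y"
    proof -
      have "proj L y \<in> V" using y sub uv by auto
      from scale_frame_coeff[OF e this] show ?thesis
        by (simp add: l_def z_def y mult.assoc flip: exp_add)
    qed
    moreover have "lift_on \<A> L \<gamma> u v l"
      unfolding lift_on_def
    proof (intro conjI ballI, goal_cases)
      case (1 t)
      then have "\<gamma> t \<in> V" using sub by blast
      then show ?case by (simp add: l_def proj_scale frame_proj[OF e])
    next
      \<comment> \<open>Parallelism is required in every frame, so the solution built in
        \<open>e\<close> is tested in each \<open>e'\<close>; the derivative of the transition
        function replaces \<open>a\<close> by \<open>b\<close>.\<close>
      case (2 Ve)
      obtain V' e' where Ve: "Ve = (V', e')" by fastforce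
      have e': "(V', e') \<in> frames L" using 2 Ve by simp
      show ?case
        unfolding Ve prod.case
      proof (intro ballI impI)
        fix t assume t: "t \<in> {u..v}" and t': "\<gamma> t \<in> V'"
        have tV: "\<gamma> t \<in> V" using sub t by blast
        have coeff: "frame_coeff L e' (l r) = z r * frame_coeff L e' (e (\<gamma> r))"
          if "\<gamma> r \<in> V" "\<gamma> r \<in> V'" for r
          unfolding l_def by (rule frame_coeff_scale[OF e']) (simp add: frame_proj[OF e that(1)] that)
        define b where "b = potential L (V', e') (\<gamma> t) [push \<A> \<gamma> t 1]"
        have "((\<lambda>r. frame_coeff L e' (e (\<gamma> r))) has_vector_derivative
            (a t - b) * frame_coeff L e' (e (\<gamma> t))) (at t)"
          using has_derivative_imp_has_vector_derivative[OF
            transition_has_derivative_along[OF e' e \<gamma> UNIV_I t' tV]]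
          by (simp add: a_def b_def)
        then have "((\<lambda>r. z r * frame_coeff L e' (e (\<gamma> r))) has_vector_derivative
            z t * ((a t - b) * frame_coeff L e' (e (\<gamma> t))) + - a t * z t * frame_coeff L e' (e (\<gamma> t)))
            (at t within {u..v})"
          by (rule has_vector_derivative_mult[OF z[OF t] has_vector_derivative_at_within])
        also have "z t * ((a t - b) * frame_coeff L e' (e (\<gamma> t))) + - a t * z t * frame_coeff L e' (e (\<gamma> t))
            = - b * frame_coeff L e' (l t)"
          by (simp add: coeff[OF tV t'] algebra_simps)
        finally have "((\<lambda>r. z r * frame_coeff L e' (e (\<gamma> r))) has_vector_derivative
            - b * frame_coeff L e' (l t)) (at t within {u..v})" .
        \<comment> \<open>The loop may leave \<open>V'\<close>, so the product formula for the
          coefficient in \<open>e'\<close> is available only near \<open>t\<close>.\<close>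
        moreover have "\<forall>\<^sub>F r in at t within {u..v}. z r * frame_coeff L e' (e (\<gamma> r)) = frame_coeff L e' (l r)"
        proof -
          have "open (\<gamma> -` V')"
            using smooth_into_open_vimage[OF \<gamma> open_frame[OF e']] by simp
          then show ?thesis
            unfolding eventually_at_topological using t' subsetD[OF sub imageI] coeff
            by (intro exI[of _ "\<gamma> -` V'"]) simp
        qed
        ultimately show "((\<lambda>r. frame_coeff L e' (l r)) has_vector_derivative
           - potential L (V', e') (\<gamma> t) [push \<A> \<gamma> t 1] * frame_coeff L e' (l t)) (at t within {u..v})"
          unfolding has_vector_derivative_def b_def
          by (rule has_derivative_transform_eventually) (simp_all add: coeff[OF tV t'] t[unfolded atLeastAtMost_iff])
      qed
    qed
    ultimately show ?thesis by blast
  qed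
  ultimately show ?thesis unfolding transport_def a_def by blast
qed

text \<open>Only the coordinates at the two ends change; the lifts, and with them the existence
  clause, stay the same.\<close>

lemma transport_change_frames:
  assumes T: "transport \<A> L \<gamma> u v e e' F" and uv: "u \<le> v"
    and e: "(V, e) \<in> frames L" "\<gamma> u \<in> V" and e': "(V', e') \<in> frames L" "\<gamma> v \<in> V'"
    and d: "(W, d) \<in> frames L" "\<gamma> u \<in> W" and d': "(W', d') \<in> frames L" "\<gamma> v \<in> W'"
  shows "transport \<A> L \<gamma> u v d d' (frame_coeff L d (e (\<gamma> u)) * F * frame_coeff L e' (d' (\<gamma> v)))"
  unfolding transport_def
proof (intro conjI allI impI)
  fix l assume l: "lift_on \<A> L \<gamma> u v l"
  have p: "proj L (l u) = \<gamma> u" "proj L (l v) = \<gamma> v" using lift_on_proj[OF l] uv by auto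
  have "frame_coeff L e (l u) = F * frame_coeff L e' (l v)" using T l by (simp add: transport_def)
  then show "frame_coeff L d (l u)
      = frame_coeff L d (e (\<gamma> u)) * F * frame_coeff L e' (d' (\<gamma> v)) * frame_coeff L d' (l v)"
    using frame_coeff_change[OF d(1) e(1), of "l u"] frame_coeff_change[OF e'(1) d'(1), of "l v"]
      d(2) e(2) d'(2) e'(2) by (simp add: p)
qed (use T in \<open>simp add: transport_def\<close>)

text \<open>Any lift shows that \<open>F\<close> has the defining property of the holonomy.
  Uniqueness needs a lift that is not zero, and the one ending at the unit vector
  \<open>e (\<gamma> 0)\<close> serves.\<close>

lemma hol_eq_transport:
  assumes T: "transport \<A> L \<gamma> 0 1 e e F" and e: "(V, e) \<in> frames L" "\<gamma> 0 \<in> V" and per: "\<gamma> 1 = \<gamma> 0"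
  shows "hol \<A> L \<gamma> = F"
  unfolding hol_def
proof (rule the_equality)
  show "\<forall>l. parallel_lift \<A> L \<gamma> l \<longrightarrow> l 0 = scale L F (l 1)"
  proof (intro allI impI)
    fix l assume "parallel_lift \<A> L \<gamma> l"
    then have l: "lift_on \<A> L \<gamma> 0 1 l" by (simp only: parallel_lift_eq_lift_on)
    have p: "proj L (l 0) = \<gamma> 0" "proj L (l 1) = \<gamma> 0" using lift_on_proj[OF l] per by auto
    have "l 0 = scale L (frame_coeff L e (l 0)) (e (\<gamma> 0))"
      using scale_frame_coeff[OF e(1), of "l 0"] e(2) by (simp add: p)
    also have "frame_coeff L e (l 0) = F * frame_coeff L e (l 1)"
      using T l by (simp add: transport_def)
    also have "scale L (F * frame_coeff L e (l 1)) (e (\<gamma> 0)) = scale L F (l 1)"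
      using scale_frame_coeff[OF e(1), of "l 1"] e(2) by (simp add: p flip: scale_scale)
    finally show "l 0 = scale L F (l 1)" .
  qed
  fix z assume z: "\<forall>l. parallel_lift \<A> L \<gamma> l \<longrightarrow> l 0 = scale L z (l 1)"
  have "proj L (e (\<gamma> 0)) = \<gamma> 1" using frame_proj[OF e] per by simp
  then obtain l where l: "lift_on \<A> L \<gamma> 0 1 l" "l 1 = e (\<gamma> 0)"
    using T unfolding transport_def by blast
  have one: "frame_coeff L e (e (\<gamma> 0)) = 1"
  proof -
    have "scale L 1 (e (\<gamma> 0)) = e (\<gamma> 0)"
      using herm unfolding hermitian_line_bundle_def by (elim conjE) (elim allE)
    with frame_coeff_scale_frame[OF e, of 1] show ?thesis by simp
  qed
  have "l 0 = scale L z (e (\<gamma> 0))" using z l unfolding parallel_lift_eq_lift_on by metis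
  then have "z = frame_coeff L e (l 0)" using frame_coeff_scale_frame[OF e] by simp
  also have "\<dots> = F" using T l one by (simp add: transport_def)
  finally show "z = F" .
qed

text \<open>Differentiating under the integral sign, \<open>\<partial>\<^sub>t a(\<partial>\<^sub>s f) = \<partial>\<^sub>s a(\<partial>\<^sub>t f) - da(\<partial>\<^sub>s f, \<partial>\<^sub>t f)\<close>.\<close>

lemma transport_variation_in_frame:
  fixes f :: "real \<times> real \<Rightarrow> 'm"
  assumes f: "smooth_into \<A> UNIV f" and e: "(V, e) \<in> frames L"
    and \<epsilon>: "0 < \<epsilon>" and uv: "u \<le> v" and sub: "f ` ({- \<epsilon>..\<epsilon>} \<times> {u..v}) \<subseteq> V"
  obtains I F where
    "((\<lambda>s. curvature \<A> L (f (0, s)) [push \<A> f (0, s) (0, 1), push \<A> f (0, s) (1, 0)]) has_integral I) {u..v}"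
    "F 0 \<noteq> 0"
    "(F has_vector_derivative F 0 * (- I + potential L (V, e) (f (0, v)) [push \<A> f (0, v) (1, 0)]
       - potential L (V, e) (f (0, u)) [push \<A> f (0, u) (1, 0)])) (at 0)"
    "\<And>t. t \<in> {- \<epsilon>..\<epsilon>} \<Longrightarrow> transport \<A> L (\<lambda>s. f (t, s)) u v e e (F t)"
proof -
  define h where "h w = (\<lambda>x. potential L (V, e) (f x) [push \<A> f x w])" for w
  \<comment> \<open>\<open>D w x w'\<close> differentiates the component of the potential along the
    image of \<open>w\<close> in direction \<open>w'\<close>; (1, 0) is the t-direction and (0, 1)
    the s-direction.\<close>
  define D where "D w x = frechet_derivative (h w) (at x)" for w x
  note pull = one_form_pullback[OF atlas potential_form[OF e] open_frame[OF e] f UNIV_I, folded h_def D_def]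
  have in_V: "f (t, s) \<in> V" if "t \<in> {- \<epsilon>..\<epsilon>}" "s \<in> {u..v}" for t s
    using sub that by blast
  have D: "(h w has_derivative D w (t, s)) (at (t, s))" if "t \<in> {- \<epsilon>..\<epsilon>}" "s \<in> {u..v}" for t s w
    using pull(1)[OF in_V[OF that]] by simp
  have cont_D: "continuous_on ({- \<epsilon>..\<epsilon>} \<times> {u..v}) (\<lambda>x. D w x w')" for w w'
    by (intro continuous_at_imp_continuous_on ballI pull(2)) (use in_V in auto)
  have cont_h: "continuous_on {u..v} (\<lambda>s. h w (t, s))" if "t \<in> {- \<epsilon>..\<epsilon>}" for w t
    by (rule continuous_on_vector_derivative) (rule partial_derivatives(2)[OF D[OF that]])
  have cont_D0: "continuous_on {u..v} (\<lambda>s. D w (0, s) w')" for w w'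
    by (rule continuous_on_compose2[OF cont_D, of _ "\<lambda>s. (0, s)"]) (use \<epsilon> in \<open>auto intro!: continuous_intros\<close>)
  define I where "I = integral {u..v} (\<lambda>s. D (1, 0) (0, s) (0, 1) - D (0, 1) (0, s) (1, 0))"
  define F where "F t = exp (integral {u..v} (\<lambda>s. h (0, 1) (t, s)))" for t
  have curv: "curvature \<A> L (f (0, s)) [push \<A> f (0, s) (0, 1), push \<A> f (0, s) (1, 0)]
      = D (1, 0) (0, s) (0, 1) - D (0, 1) (0, s) (1, 0)" if s: "s \<in> {u..v}" for s
  proof -
    have V: "f (0, s) \<in> V" using in_V s \<epsilon> by simp
    obtain c where c: "c \<in> \<A>" "f (0, s) \<in> fst c" by (rule chart_at[OF atlas])
    note tangent = push_tangent[OF atlas f UNIV_I]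
    show ?thesis
      by (simp only: curvature_eq[OF e V tangent tangent]
        ext_d_one_form[OF atlas potential_form[OF e] open_frame[OF e] V tangent tangent c]
        pull(3)[OF V c])
  qed
  have int_D: "(\<lambda>s. D w (0, s) w') integrable_on {u..v}" for w w'
    by (rule integrable_continuous_interval[OF cont_D0])
  have has_I: "((\<lambda>s. D (1, 0) (0, s) (0, 1) - D (0, 1) (0, s) (1, 0)) has_integral I) {u..v}"
    unfolding I_def by (intro integrable_integral integrable_diff int_D)
  have 1: "((\<lambda>s. curvature \<A> L (f (0, s)) [push \<A> f (0, s) (0, 1), push \<A> f (0, s) (1, 0)]) has_integral I) {u..v}"
    by (rule has_integral_eq[OF _ has_I]) (simp add: curv)
  \<comment> \<open>This half of the curvature is an s-derivative and integrates to the boundary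
    terms; the other half is the integrand needed for the t-derivative.\<close>
  have "((\<lambda>s. D (1, 0) (0, s) (0, 1)) has_integral h (1, 0) (0, v) - h (1, 0) (0, u)) {u..v}"
    by (rule fundamental_theorem_of_calculus[OF uv]) (use \<epsilon> in \<open>intro partial_derivatives(2) D, auto\<close>)
  from has_integral_diff[OF this has_I]
  have int: "integral {u..v} (\<lambda>s. D (0, 1) (0, s) (1, 0)) = - I + h (1, 0) (0, v) - h (1, 0) (0, u)"
    by (auto dest: integral_unique)
  have "((\<lambda>t. integral (cbox u v) (\<lambda>s. h (0, 1) (t, s))) has_vector_derivative
      integral (cbox u v) (\<lambda>s. D (0, 1) (0, s) (1, 0))) (at 0 within {- \<epsilon>..\<epsilon>})"
  proof (rule leibniz_rule_vector_derivative[where fx = "\<lambda>t s. D (0, 1) (t, s) (1, 0)"])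
    show "((\<lambda>t. h (0, 1) (t, s)) has_vector_derivative D (0, 1) (t, s) (1, 0)) (at t within {- \<epsilon>..\<epsilon>})"
      if "t \<in> {- \<epsilon>..\<epsilon>}" "s \<in> cbox u v" for t s
      using that by (intro partial_derivatives(1) D) auto
    show "(\<lambda>s. h (0, 1) (t, s)) integrable_on cbox u v" if "t \<in> {- \<epsilon>..\<epsilon>}" for t
      using integrable_continuous_interval[OF cont_h[OF that]] by simp
    show "continuous_on ({- \<epsilon>..\<epsilon>} \<times> cbox u v) (\<lambda>(t, s). D (0, 1) (t, s) (1, 0))"
      using cont_D[of "(0, 1)" "(1, 0)"] by (simp add: case_prod_beta')
  qed (use \<epsilon> in auto)
  then have "((\<lambda>t. integral {u..v} (\<lambda>s. h (0, 1) (t, s))) has_vector_derivative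
      - I + h (1, 0) (0, v) - h (1, 0) (0, u)) (at 0)"
    using at_within_interior[of 0 "{- \<epsilon>..\<epsilon>}"] \<epsilon> by (simp add: int)
  from field_vector_diff_chain_at[OF this DERIV_exp]
  have 2: "(F has_vector_derivative F 0 * (- I + h (1, 0) (0, v) - h (1, 0) (0, u))) (at 0)"
    by (simp add: F_def[abs_def] comp_def mult.commute)
  have 3: "transport \<A> L (\<lambda>s. f (t, s)) u v e e (F t)" if "t \<in> {- \<epsilon>..\<epsilon>}" for t
  proof -
    have "(\<lambda>s. f (t, s)) ` {u..v} \<subseteq> V" using in_V[OF that] by blast
    from transport_in_frame[OF e slice2_smooth[OF atlas f] this uv]
    show ?thesis by (simp add: F_def h_def push_slice2[OF atlas f])
  qed
  show thesis
    by (rule that[OF 1 _ 2[unfolded h_def] 3]) (auto simp: F_def)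
qed

text \<open>Stated for all frames at the two ends, so that it is additive in the interval and can be proved
  by bisection.\<close>

definition variation_formula :: "(real \<times> real \<Rightarrow> 'm) \<Rightarrow> real \<Rightarrow> real \<Rightarrow> bool" where
  "variation_formula f u v \<longleftrightarrow>
     (\<exists>I. ((\<lambda>s. curvature \<A> L (f (0, s)) [push \<A> f (0, s) (0, 1), push \<A> f (0, s) (1, 0)]) has_integral I) {u..v} \<and>
        (\<forall>V e V' e'. (V, e) \<in> frames L \<longrightarrow> (V', e') \<in> frames L \<longrightarrow> f (0, u) \<in> V \<longrightarrow> f (0, v) \<in> V' \<longrightarrow>
          (\<exists>F. F 0 \<noteq> 0 \<and>
             (F has_vector_derivative F 0 * (- I + potential L (V', e') (f (0, v)) [push \<A> f (0, v) (1, 0)]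
                - potential L (V, e) (f (0, u)) [push \<A> f (0, u) (1, 0)])) (at 0) \<and>
             (\<forall>\<^sub>F t in nhds 0. transport \<A> L (\<lambda>s. f (t, s)) u v e e' (F t)))))"

text \<open>With one frame chosen at \<open>v\<close> for both pieces, its boundary terms cancel in
  the logarithmic derivative of the product. Since \<open>I\<close> and \<open>J\<close> are fixed
  before the frames, so is their sum.\<close>

lemma variation_formula_trans:
  assumes 1: "variation_formula f u v" and 2: "variation_formula f v w" and uv: "u \<le> v" "v \<le> w"
  shows "variation_formula f u w"
proof -
  let ?\<kappa> = "\<lambda>s. curvature \<A> L (f (0, s)) [push \<A> f (0, s) (0, 1), push \<A> f (0, s) (1, 0)]"
  let ?a = "\<lambda>V e s. potential L (V, e) (f (0, s)) [push \<A> f (0, s) (1, 0)]"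
  obtain I where I: "(?\<kappa> has_integral I) {u..v}"
    and F: "\<And>V e V' e'. \<lbrakk>(V, e) \<in> frames L; (V', e') \<in> frames L; f (0, u) \<in> V; f (0, v) \<in> V'\<rbrakk> \<Longrightarrow>
          \<exists>F. F 0 \<noteq> 0 \<and> (F has_vector_derivative F 0 * (- I + ?a V' e' v - ?a V e u)) (at 0) \<and>
             (\<forall>\<^sub>F t in nhds 0. transport \<A> L (\<lambda>s. f (t, s)) u v e e' (F t))"
    using 1 unfolding variation_formula_def by blast
  obtain J where J: "(?\<kappa> has_integral J) {v..w}"
    and G: "\<And>V e V' e'. \<lbrakk>(V, e) \<in> frames L; (V', e') \<in> frames L; f (0, v) \<in> V; f (0, w) \<in> V'\<rbrakk> \<Longrightarrow>
          \<exists>F. F 0 \<noteq> 0 \<and> (F has_vector_derivative F 0 * (- J + ?a V' e' w - ?a V e v)) (at 0) \<and>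
             (\<forall>\<^sub>F t in nhds 0. transport \<A> L (\<lambda>s. f (t, s)) v w e e' (F t))"
    using 2 unfolding variation_formula_def by blast
  obtain V1 e1 where e1: "(V1, e1) \<in> frames L" "f (0, v) \<in> V1" by (rule frame_at)
  have "\<exists>K. K 0 \<noteq> 0 \<and> (K has_vector_derivative K 0 * (- (I + J) + ?a V' e' w - ?a V e u)) (at 0) \<and>
             (\<forall>\<^sub>F t in nhds 0. transport \<A> L (\<lambda>s. f (t, s)) u w e e' (K t))"
    if e: "(V, e) \<in> frames L" "f (0, u) \<in> V" and e': "(V', e') \<in> frames L" "f (0, w) \<in> V'" for V e V' e'
  proof -
    obtain F where F: "F 0 \<noteq> 0" "(F has_vector_derivative F 0 * (- I + ?a V1 e1 v - ?a V e u)) (at 0)"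
      "\<forall>\<^sub>F t in nhds 0. transport \<A> L (\<lambda>s. f (t, s)) u v e e1 (F t)"
      using F[OF e(1) e1(1) e(2) e1(2)] by blast
    obtain G where G: "G 0 \<noteq> 0" "(G has_vector_derivative G 0 * (- J + ?a V' e' w - ?a V1 e1 v)) (at 0)"
      "\<forall>\<^sub>F t in nhds 0. transport \<A> L (\<lambda>s. f (t, s)) v w e1 e' (G t)"
      using G[OF e1(1) e'(1) e1(2) e'(2)] by blast
    have "((\<lambda>t. F t * G t) has_vector_derivative (F 0 * G 0) * (- (I + J) + ?a V' e' w - ?a V e u)) (at 0)"
      using has_vector_derivative_mult[OF F(2) G(2)] by (simp add: algebra_simps)
    moreover have "\<forall>\<^sub>F t in nhds 0. transport \<A> L (\<lambda>s. f (t, s)) u w e e' (F t * G t)"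
      using F(3) G(3) by eventually_elim (rule transport_trans[OF _ _ uv])
    ultimately show ?thesis
      using F(1) G(1) by (intro exI[of _ "\<lambda>t. F t * G t"]) simp
  qed
  with has_integral_combine[OF uv I J] show ?thesis
    unfolding variation_formula_def by blast
qed

text \<open>A rectangle around (0, x) is mapped into one frame domain, where the formula for a
  single frame applies. The shape of the conclusion is the local hypothesis of
  \<open>Bolzano\<close>.\<close>

lemma variation_formula_local:
  assumes f: "smooth_into \<A> UNIV f"
  shows "\<exists>\<delta>>0. \<forall>u v. u \<le> x \<and> x \<le> v \<and> v - u < \<delta> \<longrightarrow> variation_formula f u v"
proof -
  obtain V e where e: "(V, e) \<in> frames L" "f (0, x) \<in> V" by (rule frame_at)
  have "open (f -` V)" using smooth_into_open_vimage[OF f open_frame[OF e(1)]] by simp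
  then obtain S T where ST: "open S" "open T" "(0, x) \<in> S \<times> T" "S \<times> T \<subseteq> f -` V"
    using e(2) by (elim open_prod_elim[where x = "(0, x)"]) auto
  obtain \<epsilon> where \<epsilon>: "\<epsilon> > 0" "{- \<epsilon>..\<epsilon>} \<subseteq> S"
    using ST(1,3) open_contains_cball[of S] by (auto simp: cball_eq_atLeastAtMost)
  obtain \<delta> where \<delta>: "\<delta> > 0" "cball x \<delta> \<subseteq> T"
    using ST(2,3) open_contains_cball[of T] by auto
  have "variation_formula f u v" if x: "u \<le> x" "x \<le> v" "v - u < \<delta>" for u v
  proof -
    have uv: "u \<le> v" using x by simp
    have "{u..v} \<subseteq> T" using \<delta>(2) x by (auto simp: cball_eq_atLeastAtMost)
    then have sub: "f ` ({- \<epsilon>..\<epsilon>} \<times> {u..v}) \<subseteq> V" using ST(4) \<epsilon>(2) by blast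
    then have V: "f (0, u) \<in> V" "f (0, v) \<in> V" using \<epsilon>(1) uv by auto
    obtain I F where I: "((\<lambda>s. curvature \<A> L (f (0, s)) [push \<A> f (0, s) (0, 1), push \<A> f (0, s) (1, 0)]) has_integral I) {u..v}"
      and F: "F 0 \<noteq> 0"
        "(F has_vector_derivative F 0 * (- I + potential L (V, e) (f (0, v)) [push \<A> f (0, v) (1, 0)]
           - potential L (V, e) (f (0, u)) [push \<A> f (0, u) (1, 0)])) (at 0)"
        "\<And>t. t \<in> {- \<epsilon>..\<epsilon>} \<Longrightarrow> transport \<A> L (\<lambda>s. f (t, s)) u v e e (F t)"
      using transport_variation_in_frame[OF f e(1) \<epsilon>(1) uv sub] by blast
    have "\<exists>G. G 0 \<noteq> 0 \<and>
             (G has_vector_derivative G 0 * (- I + potential L (V'', e'') (f (0, v)) [push \<A> f (0, v) (1, 0)]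
                - potential L (V', e') (f (0, u)) [push \<A> f (0, u) (1, 0)])) (at 0) \<and>
             (\<forall>\<^sub>F t in nhds 0. transport \<A> L (\<lambda>s. f (t, s)) u v e' e'' (G t))"
      if e': "(V', e') \<in> frames L" "f (0, u) \<in> V'" and e'': "(V'', e'') \<in> frames L" "f (0, v) \<in> V''"
      for V' e' V'' e''
    proof -
      \<comment> \<open>\<open>P\<close> and \<open>Q\<close> convert the fixed frame
        \<open>e\<close> to the arbitrary frames at the ends. Their logarithmic derivatives are
        differences of potentials and replace the boundary terms of \<open>e\<close>.\<close>
      define P where "P t = frame_coeff L e' (e (f (t, u)))" for t
      define Q where "Q t = frame_coeff L e (e'' (f (t, v)))" for t
      have P: "(P has_vector_derivative (potential L (V, e) (f (0, u)) [push \<A> f (0, u) (1, 0)]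
          - potential L (V', e') (f (0, u)) [push \<A> f (0, u) (1, 0)]) * P 0) (at 0)"
        using has_derivative_imp_has_vector_derivative[OF transition_has_derivative_along
          [OF e'(1) e(1) slice1_smooth[OF atlas f] UNIV_I e'(2) V(1)]]
        by (simp add: P_def[abs_def] push_slice1[OF atlas f])
      have Q: "(Q has_vector_derivative (potential L (V'', e'') (f (0, v)) [push \<A> f (0, v) (1, 0)]
          - potential L (V, e) (f (0, v)) [push \<A> f (0, v) (1, 0)]) * Q 0) (at 0)"
        using has_derivative_imp_has_vector_derivative[OF transition_has_derivative_along
          [OF e(1) e''(1) slice1_smooth[OF atlas f] UNIV_I V(2) e''(2)]]
        by (simp add: Q_def[abs_def] push_slice1[OF atlas f])
      have "P 0 \<noteq> 0" "Q 0 \<noteq> 0"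
        using transition_nonzero[OF e'(1) e(1) e'(2) V(1)]
          transition_nonzero[OF e(1) e''(1) V(2) e''(2)] by (auto simp: P_def Q_def)
      moreover have "((\<lambda>t. P t * F t * Q t) has_vector_derivative (P 0 * F 0 * Q 0) *
          (- I + potential L (V'', e'') (f (0, v)) [push \<A> f (0, v) (1, 0)]
                - potential L (V', e') (f (0, u)) [push \<A> f (0, u) (1, 0)])) (at 0)"
        using has_vector_derivative_mult[OF has_vector_derivative_mult[OF P F(2)] Q]
        by (simp add: algebra_simps)
      moreover have "\<forall>\<^sub>F t in nhds 0. transport \<A> L (\<lambda>s. f (t, s)) u v e' e'' (P t * F t * Q t)"
      proof -
        \<comment> \<open>The conversion is meaningful only where the end points lie in both frames;
          openness grants this for t near 0.\<close>
        have near: "\<forall>\<^sub>F t in nhds 0. f (t, s) \<in> X" if "open X" "f (0, s) \<in> X" for X s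
          using eventually_nhds_in_open[of "(\<lambda>t. f (t, s)) -` X" 0]
            smooth_into_open_vimage[OF slice1_smooth[OF atlas f] that(1), of s] that(2) by simp
        have "\<forall>\<^sub>F t in nhds 0. t \<in> {- \<epsilon><..<\<epsilon>}"
          by (rule eventually_nhds_in_open) (use \<epsilon> in auto)
        with near[OF open_frame[OF e'(1)] e'(2)] near[OF open_frame[OF e''(1)] e''(2)]
        show ?thesis
        proof eventually_elim
          case (elim t)
          have "f (t, u) \<in> V" "f (t, v) \<in> V" using sub elim(3) uv by auto
          with elim F(3)[of t] show ?case
            unfolding P_def Q_def
            by (intro transport_change_frames[OF _ uv e(1) _ e(1) _ e'(1) _ e''(1)]) auto
        qed
      qed
      ultimately show ?thesis
        using F(1) by (intro exI[of _ "\<lambda>t. P t * F t * Q t"]) simp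
    qed
    with I show ?thesis unfolding variation_formula_def by blast
  qed
  with \<delta>(1) show ?thesis by blast
qed

section \<open>Variation of the holonomy around closed loops\<close>

lemma hol_variation:
  assumes \<Gamma>: "loop_curve \<A> \<Gamma>"
  obtains I where
    "((\<lambda>s. curvature \<A> L (\<Gamma> 0 s) [rotation_field \<A> (\<Gamma> 0) s, loop_velocity \<A> \<Gamma> 0 s]) has_integral I) {0..1}"
    "hol \<A> L (\<Gamma> 0) \<noteq> 0"
    "((\<lambda>t. hol \<A> L (\<Gamma> t)) has_vector_derivative - I * hol \<A> L (\<Gamma> 0)) (at 0)"
proof -
  define f where "f = (\<lambda>(t, s). \<Gamma> t s)"
  have f: "smooth_into \<A> UNIV f" using \<Gamma> by (simp add: loop_curve_def f_def)
  have f_eq: "f (t, s) = \<Gamma> t s" for t s by (simp add: f_def)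
  have per: "\<Gamma> t 1 = \<Gamma> t 0" for t
    using \<Gamma> unfolding loop_curve_def by (metis add_0)
  have push1: "push \<A> f (0, s) (1, 0) = loop_velocity \<A> \<Gamma> 0 s"
    and push2: "push \<A> f (0, s) (0, 1) = rotation_field \<A> (\<Gamma> 0) s" for s
    using push_slice1[OF atlas f, of s 0] push_slice2[OF atlas f, of 0 s]
    by (simp_all add: loop_velocity_def rotation_field_def f_eq)
  obtain V e where e: "(V, e) \<in> frames L" "\<Gamma> 0 0 \<in> V" by (rule frame_at)
  have eV: "f (0, 0) \<in> V" "f (0, 1) \<in> V" using e(2) by (simp_all add: f_eq per)
  \<comment> \<open>Additivity together with validity on short intervals around each point gives the
    whole interval.\<close>
  have "variation_formula f 0 1"
    by (rule Bolzano[of 0 1 "variation_formula f", OF zero_le_one])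
      (assumption | rule variation_formula_trans variation_formula_local[OF f])+
  then obtain I F where
    I: "((\<lambda>s. curvature \<A> L (f (0, s)) [push \<A> f (0, s) (0, 1), push \<A> f (0, s) (1, 0)]) has_integral I) {0..1}"
    and F: "F 0 \<noteq> 0"
      "(F has_vector_derivative F 0 * (- I + potential L (V, e) (f (0, 1)) [push \<A> f (0, 1) (1, 0)]
        - potential L (V, e) (f (0, 0)) [push \<A> f (0, 0) (1, 0)])) (at 0)"
      "\<forall>\<^sub>F t in nhds 0. transport \<A> L (\<lambda>s. f (t, s)) 0 1 e e (F t)"
    using e(1) eV unfolding variation_formula_def by blast
  \<comment> \<open>With the same frame \<open>e\<close> and the same velocity at both ends, the
    boundary terms cancel.\<close>
  have "loop_velocity \<A> \<Gamma> 0 1 = loop_velocity \<A> \<Gamma> 0 0"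
    by (simp add: loop_velocity_def per)
  with F(2) have dF: "(F has_vector_derivative - I * F 0) (at 0)"
    by (simp add: push1 f_eq per mult.commute)
  have "\<forall>\<^sub>F t in nhds 0. \<Gamma> t 0 \<in> V"
    using eventually_nhds_in_open[of "(\<lambda>t. f (t, 0)) -` V" 0]
      smooth_into_open_vimage[OF slice1_smooth[OF atlas f] open_frame[OF e(1)], of 0] e(2)
    by (simp add: f_eq)
  \<comment> \<open>\<open>F\<close> is the holonomy only for small t. The filter
    \<open>nhds 0\<close> includes t = 0, so the values at 0 agree too and the derivative carries
    over.\<close>
  with F(3) have ev: "\<forall>\<^sub>F t in nhds 0. F t = hol \<A> L (\<Gamma> t)"
  proof eventually_elim
    case (elim t)
    then show ?case
      using hol_eq_transport[OF _ e(1), of "\<Gamma> t" "F t"] per by (simp add: f_eq)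
  qed
  then have F0: "F 0 = hol \<A> L (\<Gamma> 0)" by (rule eventually_nhds_x_imp_x)
  have "((\<lambda>t. hol \<A> L (\<Gamma> t)) has_vector_derivative - I * F 0) (at 0)"
    using dF has_vector_derivative_cong_ev[of UNIV F "\<lambda>t. hol \<A> L (\<Gamma> t)" 0] ev F0 by simp
  then show thesis
    using that I F(1) unfolding F0 push1 push2 f_eq by blast
qed

end


section \<open>The connection on the holonomy bundle\<close>

text \<open>A point of the fibre is the \<open>gluing\<close> image of one representative, and that
  image has exactly one entry over each index \<alpha> whose loop space contains the loop.\<close>

lemma hol_coeff_unique:
  assumes x: "x \<in> hol_fibre \<A> U A \<gamma>" and \<alpha>: "\<gamma> \<in> loop_space \<A> (U \<alpha>)"
  shows "(\<alpha>, \<gamma>, w) \<in> x \<longleftrightarrow> w = hol_coeff \<alpha> \<gamma> x"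
proof -
  obtain \<beta> z where "\<gamma> \<in> loop_space \<A> (U \<beta>)" "x = gluing \<A> U A `` {(\<beta>, \<gamma>, z)}"
    using x unfolding hol_fibre_def by blast
  then have *: "(\<alpha>, \<gamma>, w) \<in> x \<longleftrightarrow> w = z * exp (- transgression \<A> (A \<beta> \<alpha>) \<gamma> [])" for w
    using \<alpha> by (auto simp: gluing_def)
  show ?thesis unfolding hol_coeff_def * by simp
qed

text \<open>The transgression enters the connection with a minus sign, so lowering it by
  \<open>c\<close> adds \<open>c\<close> times the section. The derivative of the coefficients is
  the same on both sides and is never evaluated.\<close>

lemma hol_nabla_shift:
  assumes x: "\<Psi> \<gamma> \<in> hol_fibre \<A> U A \<gamma>"
    and tr: "\<And>\<alpha>. \<gamma> \<in> loop_space \<A> (U \<alpha>) \<Longrightarrow>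
      transgression \<A> (B' \<alpha>) \<gamma> [X] = transgression \<A> (B \<alpha>) \<gamma> [X] - c"
  shows "hol_nabla \<A> U B' \<Psi> \<gamma> X = hol_add (hol_nabla \<A> U B \<Psi> \<gamma> X) (hol_scale c (\<Psi> \<gamma>))"
proof -
  let ?D = "\<lambda>\<alpha>. loop_d \<A> (\<lambda>\<eta>. hol_coeff \<alpha> \<eta> (\<Psi> \<eta>)) \<gamma> X"
  let ?k = "\<lambda>\<alpha>. hol_coeff \<alpha> \<gamma> (\<Psi> \<gamma>)"
  have "hol_add (hol_nabla \<A> U B \<Psi> \<gamma> X) (hol_scale c (\<Psi> \<gamma>))
      = {(\<alpha>, \<gamma>, (?D \<alpha> - transgression \<A> (B \<alpha>) \<gamma> [X] * ?k \<alpha>) + c * w) | \<alpha> w.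
           \<gamma> \<in> loop_space \<A> (U \<alpha>) \<and> (\<alpha>, \<gamma>, w) \<in> \<Psi> \<gamma>}"
    unfolding hol_add_def hol_scale_def hol_nabla_def by blast
  also have "\<dots> = {(\<alpha>, \<gamma>, (?D \<alpha> - transgression \<A> (B \<alpha>) \<gamma> [X] * ?k \<alpha>) + c * ?k \<alpha>) | \<alpha>.
           \<gamma> \<in> loop_space \<A> (U \<alpha>)}"
    by (auto simp: hol_coeff_unique[OF x])
  also have "\<dots> = hol_nabla \<A> U B' \<Psi> \<gamma> X"
    unfolding hol_nabla_def
    by (intro Collect_cong ex_cong) (auto simp: tr algebra_simps)
  finally show ?thesis ..
qed

text \<open>The integral of B plus curvature splits only for integrable summands; this covers B. As
  the velocity of a smooth curve of loops, \<open>X\<close> is a slice of a smooth pushforward in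
  two variables.\<close>

lemma two_form_along_loop_integrable:
  fixes \<A> :: "('m::{t2_space,second_countable_topology}, 'e::euclidean_space) chart set"
  assumes atlas: "smooth_atlas \<A>" and \<omega>: "is_form \<A> 2 V \<omega>" "open V"
    and \<gamma>: "\<gamma> \<in> loop_space \<A> V" and X: "X \<in> loop_tangent \<A> \<gamma>"
  shows "(\<lambda>s. \<omega> (\<gamma> s) [rotation_field \<A> \<gamma> s, X s]) integrable_on {0..1}"
proof -
  obtain \<Gamma> where \<Gamma>: "loop_curve \<A> \<Gamma>" "\<Gamma> 0 = \<gamma>" "X = loop_velocity \<A> \<Gamma> 0"
    using X unfolding loop_tangent_def by blast
  define f where "f = (\<lambda>(t, s). \<Gamma> t s)"
  have f: "smooth_into \<A> UNIV f" using \<Gamma> by (simp add: loop_curve_def f_def)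
  have f_eq: "f (t, s) = \<Gamma> t s" for t s by (simp add: f_def)
  have push: "push \<A> f (0, s) (0, 1) = rotation_field \<A> \<gamma> s" "push \<A> f (0, s) (1, 0) = X s" for s
    using push_slice1[OF atlas f, of s 0] push_slice2[OF atlas f, of 0 s] \<Gamma>
    by (simp_all add: loop_velocity_def rotation_field_def f_eq)
  have "isCont (\<lambda>s. \<omega> (f (0, s)) [push \<A> f (0, s) (0, 1), push \<A> f (0, s) (1, 0)]) s" for s
  proof -
    have *: "isCont (\<lambda>x. \<omega> (f x) [push \<A> f x (0, 1), push \<A> f x (1, 0)]) (0, s)"
      by (rule two_form_push_continuous[OF atlas \<omega> f UNIV_I])
        (use \<gamma> \<Gamma>(2) in \<open>auto simp: f_eq loop_space_def\<close>)
    show ?thesis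
      by (rule isCont_o2[where f = "\<lambda>s. (0, s)" and g = "\<lambda>x. \<omega> (f x) [push \<A> f x (0, 1), push \<A> f x (1, 0)]"])
        (use * in \<open>auto intro!: continuous_intros\<close>)
  qed
  then show ?thesis
    by (intro integrable_continuous_interval continuous_at_imp_continuous_on ballI)
      (simp add: push f_eq \<Gamma>(2))
qed

text \<open>The integral in \<open>hol_variation\<close> depends on the curve only through
  \<open>\<gamma>\<close> and \<open>X\<close>, so all curves in the description
  \<open>loop_d\<close> give one derivative; the holonomy is nonzero, so division by it is
  legitimate.\<close>

lemma loop_dln_hol:
  fixes \<A> :: "('m::{t2_space,second_countable_topology}, 'e::euclidean_space) chart set"
  assumes L: "smooth_atlas \<A>" "hermitian_line_bundle \<A> L" "unitary_connection \<A> L"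
    and X: "X \<in> loop_tangent \<A> \<gamma>"
  shows "((\<lambda>s. curvature \<A> L (\<gamma> s) [rotation_field \<A> \<gamma> s, X s]) has_integral
           - loop_dln \<A> (hol \<A> L) \<gamma> X) {0..1}"
proof -
  obtain \<Gamma> where \<Gamma>: "loop_curve \<A> \<Gamma>" "\<Gamma> 0 = \<gamma>" "loop_velocity \<A> \<Gamma> 0 = X"
    using X unfolding loop_tangent_def by blast
  obtain I where I: "((\<lambda>s. curvature \<A> L (\<gamma> s) [rotation_field \<A> \<gamma> s, X s]) has_integral I) {0..1}"
    and nz: "hol \<A> L \<gamma> \<noteq> 0"
    by (rule hol_variation[OF L \<Gamma>(1), unfolded \<Gamma>(2,3)])
  have deriv: "((\<lambda>t. hol \<A> L (\<Gamma>' t)) has_vector_derivative - I * hol \<A> L \<gamma>) (at 0)"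
    if \<Gamma>': "loop_curve \<A> \<Gamma>'" "\<Gamma>' 0 = \<gamma>" "loop_velocity \<A> \<Gamma>' 0 = X" for \<Gamma>'
  proof -
    obtain J where J: "((\<lambda>s. curvature \<A> L (\<gamma> s) [rotation_field \<A> \<gamma> s, X s]) has_integral J) {0..1}"
      "((\<lambda>t. hol \<A> L (\<Gamma>' t)) has_vector_derivative - J * hol \<A> L \<gamma>) (at 0)"
      by (rule hol_variation[OF L \<Gamma>'(1), unfolded \<Gamma>'(2,3)])
    then show ?thesis using has_integral_unique[OF I J(1)] by simp
  qed
  have "loop_d \<A> (hol \<A> L) \<gamma> X = - I * hol \<A> L \<gamma>"
    unfolding loop_d_def
  proof (rule the_equality)
    show "\<forall>\<Gamma>. loop_curve \<A> \<Gamma> \<and> \<Gamma> 0 = \<gamma> \<and> loop_velocity \<A> \<Gamma> 0 = X \<longrightarrow>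
        ((\<lambda>t. hol \<A> L (\<Gamma> t)) has_vector_derivative - I * hol \<A> L \<gamma>) (at 0)"
      using deriv by blast
    fix y
    assume "\<forall>\<Gamma>. loop_curve \<A> \<Gamma> \<and> \<Gamma> 0 = \<gamma> \<and> loop_velocity \<A> \<Gamma> 0 = X \<longrightarrow>
        ((\<lambda>t. hol \<A> L (\<Gamma> t)) has_vector_derivative y) (at 0)"
    then have "((\<lambda>t. hol \<A> L (\<Gamma> t)) has_vector_derivative y) (at 0)" using \<Gamma> by blast
    then show "y = - I * hol \<A> L \<gamma>" using deriv[OF \<Gamma>] by (rule vector_derivative_unique_at)
  qed
  then have "loop_dln \<A> (hol \<A> L) \<gamma> X = - I" using nz by (simp add: loop_dln_def)
  with I show ?thesis by simp
qed

theorem proposition3p2: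
  fixes \<A> :: "('m::{t2_space,second_countable_topology}, 'e::euclidean_space) chart set"
    and U :: "'i \<Rightarrow> 'm set"
    and g :: "'i \<Rightarrow> 'i \<Rightarrow> 'i \<Rightarrow> 'm \<Rightarrow> complex"
    and H :: "('m, 'e) form"
    and B :: "'i \<Rightarrow> ('m, 'e) form"
    and A :: "'i \<Rightarrow> 'i \<Rightarrow> ('m, 'e) form"
    and L :: "('m, 'e, 'l) line_bundle"
  assumes "smooth_atlas \<A>"
    and "brylinski_cover \<A> (range U)"
    and "gerbe_connection \<A> U g H B A"
    and "hermitian_line_bundle \<A> L"
    and "unitary_connection \<A> L"
  shows "\<forall>W \<Psi>. loop_open \<A> W \<and> smooth_hol_section \<A> U A W \<Psi> \<longrightarrow>
    (\<forall>\<gamma>\<in>W. \<forall>X\<in>loop_tangent \<A> \<gamma>.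
       hol_nabla \<A> U (pic_act \<A> L B) \<Psi> \<gamma> X
         = hol_add (hol_nabla \<A> U B \<Psi> \<gamma> X) (hol_scale (loop_dln \<A> (hol \<A> L) \<gamma> X) (\<Psi> \<gamma>)))"
proof (intro allI impI ballI)
  fix W \<Psi> \<gamma> X
  assume \<Psi>: "loop_open \<A> W \<and> smooth_hol_section \<A> U A W \<Psi>" and \<gamma>: "\<gamma> \<in> W" and X: "X \<in> loop_tangent \<A> \<gamma>"
  have "\<Psi> \<gamma> \<in> hol_fibre \<A> U A \<gamma>" using \<Psi> \<gamma> by (simp add: smooth_hol_section_def)
  \<comment> \<open>The shift must be the same for all \<alpha>, and it is because the curvature
    added to each B-field is a global form.\<close>
  moreover have "transgression \<A> (pic_act \<A> L B \<alpha>) \<gamma> [X]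
      = transgression \<A> (B \<alpha>) \<gamma> [X] - loop_dln \<A> (hol \<A> L) \<gamma> X"
    if \<alpha>: "\<gamma> \<in> loop_space \<A> (U \<alpha>)" for \<alpha>
  proof -
    have "open (U \<alpha>)" using assms(2) by (simp add: brylinski_cover_def brylinski_family_def)
    moreover have "is_form \<A> 2 (U \<alpha>) (B \<alpha>)" using assms(3) by (simp add: gerbe_connection_def)
    ultimately have "(\<lambda>s. B \<alpha> (\<gamma> s) [rotation_field \<A> \<gamma> s, X s]) integrable_on {0..1}"
      using two_form_along_loop_integrable[OF assms(1) _ _ \<alpha> X] by blast
    from integral_unique[OF has_integral_add[OF integrable_integral[OF this]
        loop_dln_hol[OF assms(1,4,5) X]]]
    show ?thesis by (simp add: transgression_def bar_form_def hat_form_def pic_act_def)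
  qed
  ultimately show "hol_nabla \<A> U (pic_act \<A> L B) \<Psi> \<gamma> X
      = hol_add (hol_nabla \<A> U B \<Psi> \<gamma> X) (hol_scale (loop_dln \<A> (hol \<A> L) \<gamma> X) (\<Psi> \<gamma>))"
    by (rule hol_nabla_shift)
qed

end
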